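(* There is a constant $C>0$ such that for every $n$, every set $T\subseteq V_n$ with $|T|$ even, and every vertex $v$ of $\operatorname{dom}(P_{T\text{-join}}(n))$, where $v$ is the characteristic vector of a $T$-join $J\subseteq E_n$, the extension complexity of the radial cone $K_{\operatorname{dom}(P_{T\text{-join}}(n))}(v)$ is at most $C\,|J|\,n^2$.
   Context: $K_n=(V_n,E_n)$ is the complete graph on $n$ nodes. For $T\subseteq V_n$ with $|T|$ even, a $T$-join is a set $J\subseteq E_n$ such that a node has odd degree in $(V_n,J)$ iff it lies in $T$. $P_{T\text{-join}}(n)$ is the convex hull of characteristic vectors of $T$-joins and $\operatorname{dom}(P_{T\text{-join}}(n)) = P_{T\text{-join}}(n)+\mathbb{R}^{E_n}_+$ (its vertices are the characteristic vectors of inclusion-minimal $T$-joins). The radial cone $K_P(v)$ of a polyhedron $P$ at $v\in P$ is the polyhedron defined by all linear inequalities valid for $P$ satisfied with equality by $v$. Extension complexity $\operatorname{xc}(P)$ is the minimum number of facets of a polyhedron $Q$ with $P=\pi(Q)$ for a linear map $\pi$.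
   Formalization: The T-join J is assumed nonempty: for T empty the only vertex is 0 with J empty, whose radial cone is the nonnegative orthant with positive extension complexity once n ≥ 2, so the bound C|J|n² = 0 fails there. *)

theory Defs
  imports Main "HOL-Library.Indicator_Function"
begin

text \<open>A vector of R^D (D a finite coordinate set) is a real-valued function that
  vanishes outside D.\<close>
definition fspace :: "'a set \<Rightarrow> ('a \<Rightarrow> real) set" where
  "fspace D = {x. \<forall>i. i \<notin> D \<longrightarrow> x i = 0}"

definition dotp :: "'a set \<Rightarrow> ('a \<Rightarrow> real) \<Rightarrow> ('a \<Rightarrow> real) \<Rightarrow> real" where
  "dotp D a x = (\<Sum>i\<in>D. a i * x i)"

definition conv_hull :: "('a \<Rightarrow> real) set \<Rightarrow> ('a \<Rightarrow> real) set" where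
  "conv_hull S = {x. \<exists>F u. finite F \<and> F \<subseteq> S \<and> F \<noteq> {} \<and> (\<forall>y\<in>F. 0 \<le> u y) \<and>
      sum u F = 1 \<and> x = (\<lambda>i. \<Sum>y\<in>F. u y * y i)}"

definition dominant :: "'a set \<Rightarrow> ('a \<Rightarrow> real) set \<Rightarrow> ('a \<Rightarrow> real) set" where
  "dominant D P = {x. \<exists>p\<in>P. \<exists>r\<in>fspace D. (\<forall>i. 0 \<le> r i) \<and> x = (\<lambda>i. p i + r i)}"

definition is_vertex :: "('a \<Rightarrow> real) \<Rightarrow> ('a \<Rightarrow> real) set \<Rightarrow> bool" where
  "is_vertex v P \<longleftrightarrow> v \<in> P \<and>
     \<not> (\<exists>a\<in>P. \<exists>b\<in>P. \<exists>t::real. a \<noteq> b \<and> 0 < t \<and> t < 1 \<and> v = (\<lambda>i. (1 - t) * a i + t * b i))"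

definition radial_cone :: "'a set \<Rightarrow> ('a \<Rightarrow> real) set \<Rightarrow> ('a \<Rightarrow> real) \<Rightarrow> ('a \<Rightarrow> real) set" where
  "radial_cone D P v = {x \<in> fspace D. \<forall>a b. (\<forall>y\<in>P. dotp D a y \<le> b) \<and> dotp D a v = b
       \<longrightarrow> dotp D a x \<le> b}"

definition polyhedron_in :: "'a set \<Rightarrow> ('a \<Rightarrow> real) set \<Rightarrow> bool" where
  "polyhedron_in D Q \<longleftrightarrow> finite D \<and>
     (\<exists>(k::nat) A b. Q = {x \<in> fspace D. \<forall>j<k. dotp D (A j) x \<le> b j})"

definition face_in :: "'a set \<Rightarrow> ('a \<Rightarrow> real) set \<Rightarrow> ('a \<Rightarrow> real) set \<Rightarrow> bool" where
  "face_in D F Q \<longleftrightarrow> (\<exists>a b. (\<forall>y\<in>Q. dotp D a y \<le> b) \<and> F = {y \<in> Q. dotp D a y = b})"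

definition aff_indep :: "('a \<Rightarrow> real) set \<Rightarrow> bool" where
  "aff_indep B \<longleftrightarrow> finite B \<and> (\<forall>u. sum u B = 0 \<and> (\<forall>i. (\<Sum>y\<in>B. u y * y i) = 0)
       \<longrightarrow> (\<forall>y\<in>B. u y = 0))"

text \<open>Affine dimension: maximal number of affinely independent points, minus one
  (the empty set has dimension -1).\<close>
definition adim :: "('a \<Rightarrow> real) set \<Rightarrow> int" where
  "adim S = Max {int (card B) | B. B \<subseteq> S \<and> aff_indep B} - 1"

definition facet_in :: "'a set \<Rightarrow> ('a \<Rightarrow> real) set \<Rightarrow> ('a \<Rightarrow> real) set \<Rightarrow> bool" where
  "facet_in D F Q \<longleftrightarrow> face_in D F Q \<and> F \<noteq> {} \<and> adim F = adim Q - 1"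

definition lin_map :: "'a set \<Rightarrow> nat \<Rightarrow> ('a \<Rightarrow> nat \<Rightarrow> real) \<Rightarrow> (nat \<Rightarrow> real) \<Rightarrow> ('a \<Rightarrow> real)" where
  "lin_map D m M y = (\<lambda>e. if e \<in> D then (\<Sum>j<m. M e j * y j) else 0)"

definition xc :: "'a set \<Rightarrow> ('a \<Rightarrow> real) set \<Rightarrow> nat" where
  "xc D P = (LEAST k. \<exists>m Q M. polyhedron_in {..<m} Q \<and> P = lin_map D m M ` Q \<and>
      card {F. facet_in {..<m} F Q} = k)"

definition Vn :: "nat \<Rightarrow> nat set" where "Vn n = {..<n}"

definition En :: "nat \<Rightarrow> nat set set" where "En n = {e. e \<subseteq> Vn n \<and> card e = 2}"

definition is_Tjoin :: "nat \<Rightarrow> nat set \<Rightarrow> nat set set \<Rightarrow> bool" where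
  "is_Tjoin n T J \<longleftrightarrow> J \<subseteq> En n \<and>
     (\<forall>v\<in>Vn n. odd (card {e\<in>J. v \<in> e}) \<longleftrightarrow> v \<in> T)"

definition P_Tjoin :: "nat \<Rightarrow> nat set \<Rightarrow> (nat set \<Rightarrow> real) set" where
  "P_Tjoin n T = conv_hull {indicator J | J. is_Tjoin n T J}"

definition dom_P_Tjoin :: "nat \<Rightarrow> nat set \<Rightarrow> (nat set \<Rightarrow> real) set" where
  "dom_P_Tjoin n T = dominant (En n) (P_Tjoin n T)"

end

theory Submission
  imports Defs "HOL-Library.Function_Algebras"
begin

text \<open>
  The radial cone at \<open>J\<close> is described by \<open>x e \<ge> 0\<close> for \<open>e \<notin> J\<close> and \<open>x(\<delta>(S)) \<ge> 1\<close> for the cuts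
  \<open>\<delta>(S)\<close> that meet \<open>J\<close> in exactly one edge. These inequalities are valid and tight because a
  \<open>T\<close>-join meets such a cut in an odd number of edges. Conversely, a valid inequality tight at \<open>J\<close>
  is \<open>c x \<ge> c(J)\<close> with \<open>c \<ge> 0\<close> and \<open>J\<close> a \<open>c\<close>-minimal \<open>T\<close>-join. If \<open>c\<close> is integral, even on
  Eulerian edge sets and \<open>c(J) > 0\<close>, then there is a cut \<open>\<delta>(S)\<close> meeting \<open>J\<close> in one edge such that
  \<open>J\<close> remains minimal when \<open>c\<close> decreases by one on \<open>\<delta>(S)\<close>; induction on \<open>c(J)\<close> and rounding give
  \<open>c x \<ge> c(J)\<close> on the cone.

  For fixed \<open>f \<in> J\<close>, the cut inequalities at cuts meeting \<open>J\<close> in \<open>f\<close> only are equivalent, by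
  max-flow min-cut, to the existence of a preflow of value \<open>1 - x f\<close> between the ends of \<open>f\<close>. This
  takes \<open>O(n\<^sup>2)\<close> variables and inequalities for every \<open>f\<close>, and a polyhedron has at most as many
  facets as defining inequalities.
\<close>

notation sym_diff (infixl "\<triangle>" 65)

section \<open>Joins and cuts\<close>

definition odd_nodes :: "'v set set \<Rightarrow> 'v set" where
  "odd_nodes Q = {v. odd (card {e\<in>Q. v \<in> e})}"

definition joins :: "'v set set \<Rightarrow> 'v set \<Rightarrow> 'v set set set" where
  "joins F T = {Q. Q \<subseteq> F \<and> odd_nodes Q = T}"

definition joined :: "'v set set \<Rightarrow> 'v \<Rightarrow> 'v \<Rightarrow> bool" where
  "joined F a b \<longleftrightarrow> joins F ({a} \<triangle> {b}) \<noteq> {}"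

definition cut :: "'v set \<Rightarrow> 'v set set" where
  "cut S = {e. e \<inter> S \<noteq> {} \<and> \<not> e \<subseteq> S}"

lemma sum_sym_diff:
  fixes c :: "'a \<Rightarrow> 'b::comm_semiring_1"
  assumes "finite A" "finite B"
  shows "sum c (A \<triangle> B) + 2 * sum c (A \<inter> B) = sum c A + sum c B"
proof -
  have "sum c (A \<triangle> B) = sum c (A - B) + sum c (B - A)"
    using assms by (intro sum.union_disjoint) auto
  moreover have "sum c A = sum c (A - B) + sum c (A \<inter> B)"
    using sum.Int_Diff[OF assms(1), of c B] by (simp add: add.commute)
  moreover have "sum c B = sum c (B - A) + sum c (A \<inter> B)"
    using sum.Int_Diff[OF assms(2), of c A] by (simp add: add.commute Int_commute)
  ultimately show ?thesis by (simp add: mult_2 ac_simps)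
qed

lemma sum_sym_diff_exchange:
  fixes c :: "'a \<Rightarrow> nat"
  assumes fin: "finite A" "finite B" "finite C"
    and pos: "\<And>e. e \<in> C \<Longrightarrow> 0 < c e \<Longrightarrow> e \<in> A \<triangle> B"
  shows "sum c (A \<triangle> C) + sum c (B \<triangle> C) = sum c A + sum c B"
proof -
  have "sum c (A \<inter> C) + sum c (B \<inter> C) = sum c (A \<inter> C \<union> B \<inter> C) + sum c (A \<inter> C \<inter> (B \<inter> C))"
    using fin by (intro sum.union_inter[symmetric]) auto
  also have "sum c (A \<inter> C \<inter> (B \<inter> C)) = 0"
    using pos by (intro sum.neutral) blast
  also have "sum c (A \<inter> C \<union> B \<inter> C) = sum c C"
    using fin pos by (intro sum.mono_neutral_left) blast+
  finally show ?thesis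
    using sum_sym_diff[OF fin(1,3), of c] sum_sym_diff[OF fin(2,3), of c] by simp
qed

lemma even_card_sym_diff:
  assumes "finite A" "finite B"
  shows "even (card (A \<triangle> B)) \<longleftrightarrow> (even (card A) \<longleftrightarrow> even (card B))"
proof -
  have "card (A \<triangle> B) + 2 * card (A \<inter> B) = card A + card B"
    using sum_sym_diff[OF assms, of "\<lambda>_. 1 :: nat"] by simp
  then show ?thesis by presburger
qed

lemma odd_nodes_empty [simp]: "odd_nodes {} = {}"
  by (simp add: odd_nodes_def)

lemma odd_nodes_singleton [simp]: "odd_nodes {e} = e"
proof -
  have "{e' \<in> {e}. v \<in> e'} = (if v \<in> e then {e} else {})" for v by auto
  then show ?thesis unfolding odd_nodes_def by auto
qed

lemma odd_nodes_sym_diff: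
  assumes "finite A" "finite B"
  shows "odd_nodes (A \<triangle> B) = odd_nodes A \<triangle> odd_nodes B"
proof -
  have "{e \<in> A \<triangle> B. v \<in> e} = {e\<in>A. v \<in> e} \<triangle> {e\<in>B. v \<in> e}" for v by auto
  then have "odd (card {e \<in> A \<triangle> B. v \<in> e}) \<longleftrightarrow>
      (odd (card {e\<in>A. v \<in> e}) \<longleftrightarrow> \<not> odd (card {e\<in>B. v \<in> e}))" for v
    using even_card_sym_diff[of "{e\<in>A. v \<in> e}" "{e\<in>B. v \<in> e}"] assms by auto
  then show ?thesis unfolding odd_nodes_def by blast
qed

lemma odd_nodes_subset_Union: "odd_nodes Q \<subseteq> \<Union>Q"
proof
  fix v assume "v \<in> odd_nodes Q"
  then have "{e\<in>Q. v \<in> e} \<noteq> {}" by (auto simp: odd_nodes_def dest: odd_card_imp_not_empty)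
  then show "v \<in> \<Union>Q" by blast
qed

lemma joins_subset: "Q \<in> joins F T \<Longrightarrow> Q \<subseteq> F"
  by (simp add: joins_def)

lemma joins_mono: "F \<subseteq> G \<Longrightarrow> joins F T \<subseteq> joins G T"
  by (auto simp: joins_def)

lemma empty_in_joins: "{} \<in> joins F {}"
  by (simp add: joins_def)

lemma singleton_in_joins: "e \<in> F \<Longrightarrow> {e} \<in> joins F e"
  by (simp add: joins_def)

lemma sym_diff_in_joins:
  assumes "finite F" "A \<in> joins F S" "B \<in> joins F T"
  shows "A \<triangle> B \<in> joins F (S \<triangle> T)"
  using assms odd_nodes_sym_diff[of A B] finite_subset[of _ F] by (auto simp: joins_def)

lemma joinedE:
  assumes "joined F a b"
  obtains Q where "Q \<in> joins F ({a} \<triangle> {b})"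
  using assms unfolding joined_def by blast

lemma joined_refl: "joined F a a"
  using empty_in_joins unfolding joined_def by force

lemma joined_sym: "joined F a b \<Longrightarrow> joined F b a"
  unfolding joined_def by (simp add: Un_commute)

lemma joined_trans:
  assumes "finite F" "joined F a b" "joined F b c"
  shows "joined F a c"
proof -
  obtain P Q where "P \<in> joins F ({a} \<triangle> {b})" "Q \<in> joins F ({b} \<triangle> {c})"
    using assms(2,3) by (elim joinedE)
  from sym_diff_in_joins[OF assms(1) this] have "P \<triangle> Q \<in> joins F (({a} \<triangle> {b}) \<triangle> ({b} \<triangle> {c}))" .
  also have "({a} \<triangle> {b}) \<triangle> ({b} \<triangle> {c}) = {a} \<triangle> {c}" by blast
  finally show ?thesis unfolding joined_def by blast
qed

lemma joined_edge: "{a, b} \<in> F \<Longrightarrow> a \<noteq> b \<Longrightarrow> joined F a b"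
  using singleton_in_joins[of "{a, b}" F] unfolding joined_def
  by (auto simp: insert_Diff_if insert_commute)

lemma joined_imp_mem_Union:
  assumes "joined F a b" "a \<noteq> b"
  shows "b \<in> \<Union>F"
proof -
  obtain Q where "Q \<in> joins F ({a} \<triangle> {b})" using assms(1) by (rule joinedE)
  then have "Q \<subseteq> F" "odd_nodes Q = {a} \<triangle> {b}" by (simp_all add: joins_def)
  then show ?thesis using odd_nodes_subset_Union[of Q] assms(2) by blast
qed

lemma cut_edge_ends:
  assumes "e \<in> cut S" "card e = 2"
  obtains a b where "e = {a, b}" "a \<in> S" "b \<notin> S"
proof -
  obtain u w where e: "e = {u, w}" using assms(2) by (auto simp: card_2_iff)
  then consider "u \<in> S" "w \<notin> S" | "w \<in> S" "u \<notin> S" using assms(1) by (auto simp: cut_def)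
  then show ?thesis using that e by cases blast+
qed

lemma cut_uminus [simp]: "cut (- S) = cut S"
  by (auto simp: cut_def)

lemma odd_card_Int_iff_cut:
  assumes "card e = 2"
  shows "odd (card (e \<inter> S)) \<longleftrightarrow> e \<in> cut S"
proof -
  obtain a b where "e = {a, b}" "a \<noteq> b" using assms by (auto simp: card_2_iff)
  then show ?thesis by (cases "a \<in> S"; cases "b \<in> S") (auto simp: cut_def)
qed

locale finite_graph =
  fixes V :: "'v set" and E :: "'v set set"
  assumes finite_nodes: "finite V"
    and edge_subset: "e \<in> E \<Longrightarrow> e \<subseteq> V"
    and card_edge: "e \<in> E \<Longrightarrow> card e = 2"
begin

lemma finite_edges: "finite E"
proof (rule finite_subset)
  show "E \<subseteq> Pow V" using edge_subset by blast
qed (simp add: finite_nodes)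

lemma finite_edge_set: "A \<subseteq> E \<Longrightarrow> finite A"
  using finite_edges finite_subset by blast

lemma cut_Int_nodes: "E \<inter> cut (S \<inter> V) = E \<inter> cut S"
  using edge_subset unfolding cut_def by blast

text \<open>Count the pairs of an edge in \<open>Q\<close> and an end of it in \<open>S\<close>, once by nodes and once by edges.\<close>

lemma odd_card_Int_cut:
  assumes "Q \<subseteq> E"
  shows "odd (card (Q \<inter> cut S)) \<longleftrightarrow> odd (card (odd_nodes Q \<inter> S))"
proof -
  have fin: "finite Q" "finite (S \<inter> V)" using finite_edge_set[OF assms] finite_nodes by auto
  have "(\<Sum>v\<in>S \<inter> V. card {e\<in>Q. v \<in> e}) = (\<Sum>e\<in>Q. card (e \<inter> S))"
  proof (rule sum_multicount_gen[OF fin(2,1)])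
    have "{v \<in> S \<inter> V. v \<in> e} = e \<inter> S" if "e \<in> Q" for e
      using that assms edge_subset by blast
    then show "\<forall>e\<in>Q. card {v \<in> S \<inter> V. v \<in> e} = card (e \<inter> S)" by simp
  qed
  moreover have "odd_nodes Q \<inter> S = {v \<in> S \<inter> V. odd (card {e\<in>Q. v \<in> e})}"
    using odd_nodes_subset_Union[of Q] assms edge_subset unfolding odd_nodes_def by blast
  moreover have "Q \<inter> cut S = {e\<in>Q. odd (card (e \<inter> S))}"
    using assms card_edge odd_card_Int_iff_cut by blast
  ultimately show ?thesis
    using even_sum_iff[OF fin(1), of "\<lambda>e. card (e \<inter> S)"]
      even_sum_iff[OF fin(2), of "\<lambda>v. card {e\<in>Q. v \<in> e}"] by simp
qed

lemma exists_second_cut_edge: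
  assumes D: "D \<subseteq> E" "odd_nodes D = {s, t}" and st: "t \<in> S" "s \<notin> S"
    and ab: "{a, b} \<in> D" "a \<in> S" "b \<notin> S" and apart: "\<not> joined {e\<in>D. e \<inter> S = {}} b s"
  obtains a' b' where "{a', b'} \<in> D" "{a, b} \<noteq> {a', b'}" "a' \<in> S" "b' \<notin> S"
    "joined {e\<in>D. e \<inter> S = {}} b b'"
proof -
  define U where "U = {e\<in>D. e \<inter> S = {}}"
  define K where "K = {w. joined U b w}"
  have finU: "finite U" using finite_edge_set[OF D(1)] by (simp add: U_def)
  have KS: "w \<notin> S" if "w \<in> K" for w
    using joined_imp_mem_Union[of U b w] that ab(3) by (cases "w = b") (auto simp: K_def U_def)
  have bK: "b \<in> K" by (simp add: K_def joined_refl)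
  have "odd_nodes D \<inter> K = {}" using D(2) st apart KS by (auto simp: K_def U_def)
  then have "even (card (D \<inter> cut K))" using odd_card_Int_cut[OF D(1), of K] by simp
  then have "D \<inter> cut K \<noteq> {{a, b}}" by auto
  moreover have "{a, b} \<in> D \<inter> cut K" using ab bK KS by (auto simp: cut_def)
  ultimately obtain e where e: "e \<in> D" "e \<in> cut K" "e \<noteq> {a, b}" by blast
  obtain b' a' where e': "e = {b', a'}" "b' \<in> K" "a' \<notin> K"
    using cut_edge_ends[OF e(2)] card_edge D(1) e(1) by blast
  have "a' \<in> S"
  proof (rule ccontr)
    assume "a' \<notin> S"
    then have "{b', a'} \<in> U" using e e' KS by (auto simp: U_def)
    moreover have "b' \<noteq> a'" using e' by blast
    ultimately have "joined U b' a'" by (rule joined_edge)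
    then show False using e' joined_trans[OF finU] by (auto simp: K_def)
  qed
  moreover have "{a', b'} = e" "b' \<notin> S" "joined U b b'"
    using e'(1,2) KS by (auto simp: K_def)
  ultimately show ?thesis using that[of a' b'] e(1,3) unfolding U_def by metis
qed

text \<open>The component of \<open>D\<close> outside \<open>S\<close> that contains the outer end of a crossing edge is met by a
  second crossing edge, unless it contains \<open>s\<close>.\<close>

lemma exists_two_cut_edges_joined:
  assumes D: "D \<subseteq> E" "odd_nodes D = {s, t}" and st: "t \<in> S" "s \<notin> S"
    and two: "2 \<le> card (D \<inter> cut S)"
  obtains a b a' b' where "{a, b} \<in> D" "{a', b'} \<in> D" "{a, b} \<noteq> {a', b'}"
    "a \<in> S" "a' \<in> S" "b \<notin> S" "b' \<notin> S" "joined {e\<in>D. e \<inter> S = {}} b b'"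
proof -
  let ?U = "{e\<in>D. e \<inter> S = {}}"
  have finU: "finite ?U" using finite_edge_set[OF D(1)] by simp
  obtain e e' where e: "e \<in> D \<inter> cut S" "e' \<in> D \<inter> cut S" "e \<noteq> e'"
    using two card_le_Suc0_iff_eq[of "D \<inter> cut S"] finite_edge_set[OF D(1)] by auto
  obtain a b where ab: "e = {a, b}" "a \<in> S" "b \<notin> S"
    using cut_edge_ends[of e S] e(1) D(1) card_edge by blast
  obtain a' b' where ab': "e' = {a', b'}" "a' \<in> S" "b' \<notin> S"
    using cut_edge_ends[of e' S] e(2) D(1) card_edge by blast
  consider (joined) "joined ?U b b'" | (apart) "\<not> joined ?U b s" | (apart') "\<not> joined ?U b' s"
    using joined_trans[OF finU, of b s b'] joined_sym[of ?U b' s] by blast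
  then show ?thesis
  proof cases
    case joined
    then show ?thesis using that[of a b a' b'] e ab ab' by simp
  next
    case apart
    have abD: "{a, b} \<in> D" using e(1) ab(1) by simp
    show ?thesis
      by (rule exists_second_cut_edge[OF D st abD ab(2,3) apart])
        (rule that[OF abD _ _ ab(2) _ ab(3)])
  next
    case apart'
    have abD': "{a', b'} \<in> D" using e(2) ab'(1) by simp
    show ?thesis
      by (rule exists_second_cut_edge[OF D st abD' ab'(2,3) apart'])
        (rule that[OF abD' _ _ ab'(2) _ ab'(3)])
  qed
qed

lemma exists_excursion:
  assumes D: "D \<subseteq> E" "odd_nodes D = {s, t}" and "t \<in> S" "s \<notin> S"
    and "2 \<le> card (D \<inter> cut S)"
  obtains a a' P where "a \<in> S" "a' \<in> S" "P \<in> joins D ({a} \<triangle> {a'})" "card (P \<inter> cut S) = 2"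
proof -
  obtain a b a' b' where ab: "{a, b} \<in> D" "{a', b'} \<in> D" "{a, b} \<noteq> {a', b'}"
    "a \<in> S" "a' \<in> S" "b \<notin> S" "b' \<notin> S" and outside: "joined {e\<in>D. e \<inter> S = {}} b b'"
    by (rule exists_two_cut_edges_joined[OF assms])
  obtain Q where Q: "Q \<in> joins {e\<in>D. e \<inter> S = {}} ({b} \<triangle> {b'})"
    using outside by (rule joinedE)
  define P where "P = ({{a, b}} \<triangle> {{a', b'}}) \<triangle> Q"
  have "Q \<in> joins D ({b} \<triangle> {b'})" by (rule subsetD[OF joins_mono Q]) auto
  then have "P \<in> joins D (({a, b} \<triangle> {a', b'}) \<triangle> ({b} \<triangle> {b'}))"
    unfolding P_def
    by (intro sym_diff_in_joins[OF finite_edge_set[OF D(1)]] singleton_in_joins ab(1,2))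
  also have "({a, b} \<triangle> {a', b'}) \<triangle> ({b} \<triangle> {b'}) = {a} \<triangle> {a'}"
  proof -
    have "a \<noteq> b" "a \<noteq> b'" "a' \<noteq> b" "a' \<noteq> b'" using ab(4-7) by metis+
    then show ?thesis by auto
  qed
  finally have P: "P \<in> joins D ({a} \<triangle> {a'})" .
  have "Q \<inter> cut S = {}" using joins_subset[OF Q] by (auto simp: cut_def)
  moreover have "{a, b} \<in> cut S" "{a', b'} \<in> cut S" using ab(4-7) by (auto simp: cut_def)
  ultimately have "P \<inter> cut S = {{a, b}, {a', b'}}" unfolding P_def using ab(3) by blast
  then have "card (P \<inter> cut S) = 2" using ab(3) by simp
  with ab(4,5) P show ?thesis by (rule that)
qed

end

section \<open>Minimum-weight joins\<close>

definition min_join :: "'v set set \<Rightarrow> ('v set \<Rightarrow> 'a::{comm_monoid_add, ord}) \<Rightarrow> 'v set set \<Rightarrow> bool" where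
  "min_join E c J \<longleftrightarrow> J \<subseteq> E \<and> (\<forall>J'\<in>joins E (odd_nodes J). sum c J \<le> sum c J')"

text \<open>The cut to be reduced is induced by the weight-zero component of \<open>t\<close>, where \<open>J0\<close> is lightest
  among all joins whose odd nodes differ from \<open>T\<close> in at most two nodes.\<close>

locale near_min_join = finite_graph V E
  for V :: "'v set" and E :: "'v set set" +
  fixes c :: "'v set \<Rightarrow> nat" and T :: "'v set" and s t :: 'v and J0 :: "'v set set"
  assumes even_weight: "C \<in> joins E {} \<Longrightarrow> even (sum c C)"
    and J0: "J0 \<in> joins E (T \<triangle> ({s} \<triangle> {t}))"
    and J0_le: "K \<in> joins E (T \<triangle> ({a} \<triangle> {b})) \<Longrightarrow> sum c J0 \<le> sum c K"
    and J0_less: "K \<in> joins E T \<Longrightarrow> sum c J0 < sum c K"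
begin

definition zero_edges :: "'v set set" where
  "zero_edges = {e\<in>E. c e = 0}"

definition zero_component :: "'v set" where
  "zero_component = {w. joined zero_edges t w}"

abbreviation \<delta> :: "'v set set" where
  "\<delta> \<equiv> cut zero_component"

lemma zero_edges_subset: "zero_edges \<subseteq> E"
  by (auto simp: zero_edges_def)

lemma finite_zero_edges: "finite zero_edges"
  by (rule finite_edge_set[OF zero_edges_subset])

lemma t_in_zero_component: "t \<in> zero_component"
  by (simp add: zero_component_def joined_refl)

lemma joined_zero_component:
  "a \<in> zero_component \<Longrightarrow> b \<in> zero_component \<Longrightarrow> joined zero_edges a b"
  using joined_trans[OF finite_zero_edges] joined_sym by (fastforce simp: zero_component_def)

lemma sum_sym_diff_zero_edges:
  assumes "A \<subseteq> E" "Q \<subseteq> zero_edges"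
  shows "sum c (A \<triangle> Q) = sum c A"
proof -
  have "sum c P = 0" if "P \<subseteq> zero_edges" for P
    using that by (intro sum.neutral) (auto simp: zero_edges_def)
  then have "sum c Q = 0" "sum c (A \<inter> Q) = 0" using assms(2) by blast+
  then show ?thesis
    using sum_sym_diff[of A Q c] finite_edge_set assms zero_edges_subset by auto
qed

lemma s_notin_zero_component: "s \<notin> zero_component"
proof
  assume "s \<in> zero_component"
  then obtain Q where Q: "Q \<in> joins zero_edges ({t} \<triangle> {s})"
    unfolding zero_component_def by (auto elim: joinedE)
  then have "J0 \<triangle> Q \<in> joins E ((T \<triangle> ({s} \<triangle> {t})) \<triangle> ({t} \<triangle> {s}))"
    using sym_diff_in_joins[OF finite_edges J0] joins_mono[OF zero_edges_subset] by blast
  also have "(T \<triangle> ({s} \<triangle> {t})) \<triangle> ({t} \<triangle> {s}) = T" by blast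
  finally have "sum c J0 < sum c (J0 \<triangle> Q)" by (rule J0_less)
  then show False
    using sum_sym_diff_zero_edges[OF joins_subset[OF J0] joins_subset[OF Q]] by simp
qed

lemma cut_edge_pos:
  assumes "e \<in> E \<inter> \<delta>"
  shows "0 < c e"
proof (rule ccontr)
  assume "\<not> 0 < c e"
  then have zero: "e \<in> zero_edges" using assms by (simp add: zero_edges_def)
  obtain a b where e: "e = {a, b}" "a \<in> zero_component" "b \<notin> zero_component"
    using assms card_edge by (auto elim: cut_edge_ends)
  then have "joined zero_edges a b" using joined_edge zero by metis
  then show False
    using e(2,3) joined_trans[OF finite_zero_edges] by (auto simp: zero_component_def)
qed

text \<open>An optimal join that uses an edge \<open>{a, b}\<close> of the cut could be rerouted along weight zero
  from \<open>t\<close> to \<open>a\<close>, which would save that edge and replace the exceptional pair \<open>s, t\<close> by \<open>s, b\<close>.\<close>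

lemma optimal_avoids_cut:
  assumes K: "K \<in> joins E (T \<triangle> ({s} \<triangle> {t}))" and opt: "sum c K = sum c J0"
  shows "K \<inter> \<delta> = {}"
proof (rule ccontr)
  assume "K \<inter> \<delta> \<noteq> {}"
  then obtain e where e: "e \<in> K" "e \<in> \<delta>" by blast
  have KE: "K \<subseteq> E" by (rule joins_subset[OF K])
  obtain a b where ab: "e = {a, b}" "a \<in> zero_component" "b \<notin> zero_component"
    using e KE card_edge by (meson cut_edge_ends subsetD)
  obtain Q where Q: "Q \<in> joins zero_edges ({t} \<triangle> {a})"
    using joined_zero_component[OF t_in_zero_component ab(2)] by (rule joinedE)
  have "(K \<triangle> {e}) \<triangle> Q \<in> joins E (((T \<triangle> ({s} \<triangle> {t})) \<triangle> e) \<triangle> ({t} \<triangle> {a}))"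
    using K Q e(1) KE joins_mono[OF zero_edges_subset]
    by (intro sym_diff_in_joins[OF finite_edges] singleton_in_joins) blast+
  also have "((T \<triangle> ({s} \<triangle> {t})) \<triangle> e) \<triangle> ({t} \<triangle> {a}) = T \<triangle> ({s} \<triangle> {b})"
    using ab by blast
  finally have "sum c J0 \<le> sum c ((K \<triangle> {e}) \<triangle> Q)" by (rule J0_le)
  also have "\<dots> = sum c (K \<triangle> {e})"
    using e KE joins_subset[OF Q] by (intro sum_sym_diff_zero_edges) auto
  also have "K \<triangle> {e} = K - {e}" using e(1) by blast
  also have "sum c (K - {e}) < sum c K"
    using sum.remove[OF finite_edge_set[OF KE] e(1), of c] cut_edge_pos[of e] e KE by auto
  finally show False using opt by simp
qed

lemma exists_exchange_cycle:
  assumes J': "J' \<in> joins E T" and two: "2 \<le> card (J' \<inter> \<delta>)"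
  obtains C where "C \<in> joins E {}" "C \<inter> \<delta> \<subseteq> J'" "card (C \<inter> \<delta>) = 2"
    "\<And>e. e \<in> C \<Longrightarrow> 0 < c e \<Longrightarrow> e \<in> J' \<triangle> J0"
proof -
  define D where "D = J' \<triangle> J0"
  have "D \<in> joins E (T \<triangle> (T \<triangle> ({s} \<triangle> {t})))"
    unfolding D_def by (rule sym_diff_in_joins[OF finite_edges J' J0])
  also have "T \<triangle> (T \<triangle> ({s} \<triangle> {t})) = {s, t}"
    using t_in_zero_component s_notin_zero_component by blast
  finally have D: "D \<subseteq> E" "odd_nodes D = {s, t}" by (simp_all add: joins_def)
  have Dcut: "D \<inter> \<delta> = J' \<inter> \<delta>" using optimal_avoids_cut[OF J0 refl] by (auto simp: D_def)
  obtain a a' P where a: "a \<in> zero_component" "a' \<in> zero_component"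
    and P: "P \<in> joins D ({a} \<triangle> {a'})" "card (P \<inter> \<delta>) = 2"
    by (rule exists_excursion[OF D t_in_zero_component s_notin_zero_component])
      (use two Dcut in simp)
  obtain R where R: "R \<in> joins zero_edges ({a} \<triangle> {a'})"
    using joined_zero_component[OF a] by (rule joinedE)
  have R0: "c e = 0" if "e \<in> R" for e
    using that joins_subset[OF R] by (auto simp: zero_edges_def)
  have Rcut: "R \<inter> \<delta> = {}" using R0 cut_edge_pos joins_subset[OF R] zero_edges_subset by fastforce
  have "P \<triangle> R \<in> joins E (({a} \<triangle> {a'}) \<triangle> ({a} \<triangle> {a'}))"
    using subsetD[OF joins_mono[OF D(1)] P(1)] subsetD[OF joins_mono[OF zero_edges_subset] R]
    by (rule sym_diff_in_joins[OF finite_edges])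
  then have "P \<triangle> R \<in> joins E {}" by simp
  moreover have "(P \<triangle> R) \<inter> \<delta> = P \<inter> \<delta>" using Rcut by blast
  moreover have "P \<inter> \<delta> \<subseteq> J'" using joins_subset[OF P(1)] Dcut by blast
  moreover have "e \<in> J' \<triangle> J0" if "e \<in> P \<triangle> R" "0 < c e" for e
  proof -
    have "e \<notin> R" using that(2) R0[of e] by auto
    then have "e \<in> D" using that(1) joins_subset[OF P(1)] by blast
    then show ?thesis by (simp add: D_def)
  qed
  ultimately show ?thesis using that[of "P \<triangle> R"] P(2) by simp
qed

text \<open>Exchanging along the cycle makes \<open>J0\<close> cross the cut, hence heavier, and by parity by at
  least two.\<close>

lemma exists_lighter_join:
  assumes J': "J' \<in> joins E T" and "2 \<le> card (J' \<inter> \<delta>)"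
  obtains J'' where "J'' \<in> joins E T" "sum c J'' + 2 \<le> sum c J'"
    "card (J'' \<inter> \<delta>) + 2 = card (J' \<inter> \<delta>)"
proof -
  obtain C where C: "C \<in> joins E {}" "C \<inter> \<delta> \<subseteq> J'" "card (C \<inter> \<delta>) = 2"
    and pos: "\<And>e. e \<in> C \<Longrightarrow> 0 < c e \<Longrightarrow> e \<in> J' \<triangle> J0"
    using exists_exchange_cycle[OF assms] by blast
  have fin: "finite J'" "finite J0" "finite C"
    using J' J0 C(1) finite_edge_set joins_subset by blast+
  have swap: "sum c (J' \<triangle> C) + sum c (J0 \<triangle> C) = sum c J' + sum c J0"
    using fin pos by (rule sum_sym_diff_exchange)
  have J0C: "J0 \<triangle> C \<in> joins E (T \<triangle> ({s} \<triangle> {t}))"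
    using sym_diff_in_joins[OF finite_edges J0 C(1)] by simp
  have "C \<inter> \<delta> \<noteq> {}" using C(3) by fastforce
  then have "(J0 \<triangle> C) \<inter> \<delta> \<noteq> {}" using optimal_avoids_cut[OF J0 refl] by blast
  then have "sum c (J0 \<triangle> C) \<noteq> sum c J0" using optimal_avoids_cut[OF J0C] by blast
  then have "sum c J0 < sum c (J0 \<triangle> C)" using J0_le[OF J0C] by simp
  moreover have "even (sum c (J0 \<triangle> C) + sum c J0)"
  proof -
    have "even (sum c (J0 \<triangle> C) + 2 * sum c (J0 \<inter> C) + sum c J0)"
      unfolding sum_sym_diff[OF fin(2,3)] using even_weight[OF C(1)] by simp
    then show ?thesis by simp
  qed
  moreover have "m + 2 \<le> p" if "m < p" "even (p + m)" for m p :: nat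
    using that by presburger
  ultimately have "sum c J0 + 2 \<le> sum c (J0 \<triangle> C)" by blast
  moreover have "card (J' \<inter> \<delta>) = card ((J' \<triangle> C) \<inter> \<delta>) + card (C \<inter> \<delta>)"
  proof -
    have "J' \<inter> \<delta> = (J' \<triangle> C) \<inter> \<delta> \<union> C \<inter> \<delta>" using C(2) by blast
    then show ?thesis using fin C(2) by (simp only:) (intro card_Un_disjoint, auto)
  qed
  moreover have "J' \<triangle> C \<in> joins E T"
    using sym_diff_in_joins[OF finite_edges J' C(1)] by simp
  ultimately show ?thesis using that[of "J' \<triangle> C"] swap C(3) by simp
qed

lemma weight_plus_card_cut_le:
  assumes "J' \<in> joins E T" and \<tau>: "\<And>K. K \<in> joins E T \<Longrightarrow> \<tau> \<le> sum c K"
  shows "\<tau> + card (J' \<inter> \<delta>) \<le> sum c J' + 1"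
  using assms(1)
proof (induction "card (J' \<inter> \<delta>)" arbitrary: J' rule: less_induct)
  case less
  show ?case
  proof (cases "card (J' \<inter> \<delta>) \<le> 1")
    case True
    then show ?thesis using \<tau>[OF less.prems] by simp
  next
    case False
    then obtain J'' where J'': "J'' \<in> joins E T" "sum c J'' + 2 \<le> sum c J'"
      "card (J'' \<inter> \<delta>) + 2 = card (J' \<inter> \<delta>)"
      using exists_lighter_join[OF less.prems] by auto
    then show ?thesis using less.hyps[of J''] by simp
  qed
qed

lemma odd_card_Int_cut_join:
  assumes K: "K \<in> joins E T"
  shows "odd (card (K \<inter> \<delta>))"
proof -
  have "K \<triangle> J0 \<in> joins E (T \<triangle> (T \<triangle> ({s} \<triangle> {t})))"
    by (rule sym_diff_in_joins[OF finite_edges K J0])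
  also have "T \<triangle> (T \<triangle> ({s} \<triangle> {t})) = {s} \<triangle> {t}" by blast
  finally have KJ: "K \<triangle> J0 \<subseteq> E" "odd_nodes (K \<triangle> J0) = {s} \<triangle> {t}" by (simp_all add: joins_def)
  have "K \<inter> \<delta> = (K \<triangle> J0) \<inter> \<delta>" using optimal_avoids_cut[OF J0 refl] by blast
  moreover have "({s} \<triangle> {t}) \<inter> zero_component = {t}"
    using t_in_zero_component s_notin_zero_component by blast
  ultimately show ?thesis using odd_card_Int_cut[OF KJ(1), of zero_component] KJ(2) by simp
qed

end

context finite_graph
begin

lemma exists_near_min_join:
  fixes c :: "'v set \<Rightarrow> nat"
  assumes even: "\<And>C. C \<in> joins E {} \<Longrightarrow> even (sum c C)"
    and J: "min_join E c J" and pos: "0 < sum c J"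
  obtains s t J0 where "near_min_join V E c (odd_nodes J) s t J0"
proof -
  let ?near = "\<lambda>K. \<exists>a b. K \<in> joins E (odd_nodes J \<triangle> ({a} \<triangle> {b}))"
  have JE: "J \<in> joins E (odd_nodes J)" and opt: "\<And>K. K \<in> joins E (odd_nodes J) \<Longrightarrow> sum c J \<le> sum c K"
    using J by (auto simp: min_join_def joins_def)
  obtain f where f: "f \<in> J" "0 < c f" using pos by (metis not_gr_zero sum.neutral)
  have fE: "f \<in> E" using f(1) joins_subset[OF JE] by blast
  obtain a b where ab: "f = {a} \<triangle> {b}"
    using card_edge[OF fE] by (auto simp: card_2_iff)
  have near_f: "?near (J \<triangle> {f})"
    using sym_diff_in_joins[OF finite_edges JE singleton_in_joins[OF fE]] unfolding ab by blast
  have "J \<triangle> {f} = J - {f}" using f(1) by blast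
  then have less: "sum c (J \<triangle> {f}) < sum c J"
    using sum.remove[OF finite_edge_set[OF joins_subset[OF JE]] f(1), of c] f(2) by simp
  obtain J0 where J0: "?near J0" "\<And>K. ?near K \<Longrightarrow> sum c J0 \<le> sum c K"
    using ex_has_least_nat[of ?near "J \<triangle> {f}" "sum c"] near_f by blast
  then obtain s t where st: "J0 \<in> joins E (odd_nodes J \<triangle> ({s} \<triangle> {t}))" by blast
  have "near_min_join V E c (odd_nodes J) s t J0"
  proof unfold_locales
    show "sum c J0 < sum c K" if "K \<in> joins E (odd_nodes J)" for K
      using J0(2)[OF near_f] less opt[OF that] by simp
  qed (use even st J0(2) in blast)+
  then show ?thesis by (rule that)
qed

lemma sum_eq_sum_plus_card_cut:
  fixes c c' :: "'v set \<Rightarrow> nat"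
  assumes "A \<subseteq> E" and c: "\<And>e. e \<in> E \<Longrightarrow> c e = c' e + of_bool (e \<in> cut S)"
  shows "sum c A = sum c' A + card (A \<inter> cut S)"
proof -
  have "sum c A = (\<Sum>e\<in>A. c' e + of_bool (e \<in> cut S))" using assms by (intro sum.cong) auto
  then show ?thesis using finite_edge_set[OF assms(1)] by (simp add: sum.distrib Int_def)
qed

lemma exists_reducing_cut:
  fixes c :: "'v set \<Rightarrow> nat"
  assumes "\<And>C. C \<in> joins E {} \<Longrightarrow> even (sum c C)"
    and J: "min_join E c J" and "0 < sum c J"
  obtains S c' where "card (J \<inter> cut S) = 1" "\<And>e. e \<in> E \<Longrightarrow> c e = c' e + of_bool (e \<in> cut S)"
    "min_join E c' J"
proof -
  obtain s t J0 where "near_min_join V E c (odd_nodes J) s t J0"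
    using exists_near_min_join[OF assms] .
  then interpret near_min_join V E c "odd_nodes J" s t J0 .
  have JE: "J \<in> joins E (odd_nodes J)" and opt: "\<And>K. K \<in> joins E (odd_nodes J) \<Longrightarrow> sum c J \<le> sum c K"
    using J by (auto simp: min_join_def joins_def)
  have bound: "sum c J + card (K \<inter> \<delta>) \<le> sum c K + 1" if "K \<in> joins E (odd_nodes J)" for K
    using that opt by (rule weight_plus_card_cut_le)
  have one: "card (J \<inter> \<delta>) = 1"
    using bound[OF JE] odd_card_Int_cut_join[OF JE] by (cases "card (J \<inter> \<delta>)") auto
  define c' where "c' e = c e - of_bool (e \<in> \<delta>)" for e
  have c: "c e = c' e + of_bool (e \<in> \<delta>)" if "e \<in> E" for e
    using cut_edge_pos[of e] that by (simp add: c'_def)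
  note sum_c = sum_eq_sum_plus_card_cut[where c = c, OF _ c]
  have "min_join E c' J"
    unfolding min_join_def
  proof (intro conjI ballI)
    show "sum c' J \<le> sum c' K" if "K \<in> joins E (odd_nodes J)" for K
      using bound[OF that] sum_c[OF joins_subset[OF that]] sum_c[OF joins_subset[OF JE]] one by simp
  qed (rule joins_subset[OF JE])
  then show ?thesis using that one c by blast
qed

end

definition join_cone :: "'v set set \<Rightarrow> 'v set set \<Rightarrow> ('v set \<Rightarrow> real) set" where
  "join_cone E J = {x \<in> fspace E. (\<forall>e\<in>E - J. 0 \<le> x e) \<and>
     (\<forall>S. card (J \<inter> cut S) = 1 \<longrightarrow> 1 \<le> sum x (E \<inter> cut S))}"

lemma dotp_indicator:
  assumes "finite D" "A \<subseteq> D"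
  shows "dotp D a (indicator A) = sum a A"
  using assms by (simp add: dotp_def indicator_def sum.inter_restrict[symmetric] Int_absorb1
      if_distrib[of "\<lambda>r. _ * r"] cong: if_cong)

lemma min_join_mono:
  fixes c c' :: "'v set \<Rightarrow> 'a::ordered_ab_group_add"
  assumes E: "finite E" and J: "min_join E c J"
    and le: "\<And>e. e \<in> J \<Longrightarrow> c' e \<le> c e" and ge: "\<And>e. e \<in> E - J \<Longrightarrow> c e \<le> c' e"
  shows "min_join E c' J"
  unfolding min_join_def
proof (intro conjI ballI)
  show JE: "J \<subseteq> E" using J by (simp add: min_join_def)
  fix K assume K: "K \<in> joins E (odd_nodes J)"
  then have KE: "K \<subseteq> E" by (rule joins_subset)
  define h where "h e = c' e - c e" for e
  have "sum h J = sum h (J \<inter> K) + sum h (J - K)"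
    using finite_subset[OF JE E] by (rule sum.Int_Diff)
  also have "\<dots> \<le> sum h (J \<inter> K) + sum h (K - J)"
  proof (rule add_left_mono, rule order_trans)
    show "sum h (J - K) \<le> 0" using le by (intro sum_nonpos) (auto simp: h_def)
    show "0 \<le> sum h (K - J)" using ge KE by (intro sum_nonneg) (auto simp: h_def)
  qed
  also have "\<dots> = sum h K"
    using sum.Int_Diff[OF finite_subset[OF KE E], of h J] by (simp add: Int_commute)
  finally have "sum h J \<le> sum h K" .
  moreover have "sum c J \<le> sum c K" using J K by (simp add: min_join_def)
  ultimately have "sum h J + sum c J \<le> sum h K + sum c K" by (rule add_mono)
  then show "sum c' J \<le> sum c' K" by (simp add: h_def sum_subtractf)
qed

lemma min_join_scale:
  fixes c :: "'v set \<Rightarrow> 'a::ordered_semiring_0"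
  assumes "min_join E c J" "0 \<le> r"
  shows "min_join E (\<lambda>e. r * c e) J"
  using assms unfolding min_join_def sum_distrib_left[symmetric] by (simp add: mult_left_mono)

lemma min_join_of_nat_iff [simp]: "min_join E (\<lambda>e. real (c e)) J \<longleftrightarrow> min_join E c J"
  unfolding min_join_def of_nat_sum[symmetric] of_nat_le_iff ..

lemma nonpos_if_nat_multiples_bounded:
  fixes d :: real
  assumes "\<And>N. real N * d \<le> M"
  shows "d \<le> 0"
  using assms reals_Archimedean3[of d] by (meson not_le)

context finite_graph
begin

lemma dotp_eq_dotp_plus_sum_cut:
  assumes "\<And>e. e \<in> E \<Longrightarrow> c e = c' e + of_bool (e \<in> cut S)"
  shows "dotp E c x = dotp E c' x + sum x (E \<inter> cut S)"
proof -
  have "c e * x e = c' e * x e + (if e \<in> cut S then x e else 0)" if "e \<in> E" for e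
    using assms[OF that] by (simp add: distrib_right)
  then show ?thesis by (simp add: dotp_def sum.distrib sum.inter_restrict[OF finite_edges])
qed

lemma even_min_join_weight_le:
  fixes c :: "'v set \<Rightarrow> nat"
  assumes even: "\<And>C. C \<in> joins E {} \<Longrightarrow> even (sum c C)" and J: "min_join E c J"
    and x: "x \<in> join_cone E J"
  shows "real (sum c J) \<le> dotp E (\<lambda>e. real (c e)) x"
  using even J
proof (induction "sum c J" arbitrary: c rule: less_induct)
  case less
  have JE: "J \<subseteq> E" using less.prems(2) by (simp add: min_join_def)
  show ?case
  proof (cases "sum c J = 0")
    case True
    then have "c e = 0" if "e \<in> J" for e using that finite_edge_set[OF JE] by simp
    then have "0 \<le> real (c e) * x e" if "e \<in> E" for e
      using that x by (cases "e \<in> J") (auto simp: join_cone_def)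
    then show ?thesis unfolding True by (simp add: dotp_def sum_nonneg)
  next
    case False
    then obtain S c' where S: "card (J \<inter> cut S) = 1" and J': "min_join E c' J"
      and c: "\<And>e. e \<in> E \<Longrightarrow> c e = c' e + of_bool (e \<in> cut S)"
      using exists_reducing_cut[OF less.prems] by blast
    note sum_c = sum_eq_sum_plus_card_cut[where c = c, OF _ c]
    have "real (sum c' J) \<le> dotp E (\<lambda>e. real (c' e)) x"
    proof (rule less.hyps[OF _ _ J'])
      show "sum c' J < sum c J" using sum_c[OF JE] S by simp
      show "even (sum c' C)" if C: "C \<in> joins E {}" for C
      proof -
        have "C \<subseteq> E" "odd_nodes C = {}" using C by (simp_all add: joins_def)
        then have "even (card (C \<inter> cut S))" using odd_card_Int_cut[of C S] by simp
        then show ?thesis using sum_c[OF \<open>C \<subseteq> E\<close>] less.prems(1)[OF C] by simp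
      qed
    qed
    moreover have "dotp E (\<lambda>e. real (c e)) x = dotp E (\<lambda>e. real (c' e)) x + sum x (E \<inter> cut S)"
      by (rule dotp_eq_dotp_plus_sum_cut) (simp add: c)
    moreover have "1 \<le> sum x (E \<inter> cut S)" using x S by (simp add: join_cone_def)
    ultimately show ?thesis using sum_c[OF JE] S by simp
  qed
qed

text \<open>Rounding the weights down on \<open>J\<close> and up elsewhere keeps \<open>J\<close> minimal.\<close>

lemma min_join_rounding:
  fixes c :: "'v set \<Rightarrow> real"
  assumes J: "min_join E c J" and nonneg: "\<And>e. e \<in> E \<Longrightarrow> 0 \<le> c e"
  obtains k :: "'v set \<Rightarrow> nat" where "min_join E k J" "\<And>e. e \<in> E \<Longrightarrow> \<bar>c e - real (k e)\<bar> \<le> 1"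
proof -
  define k where "k e = (if e \<in> J then nat \<lfloor>c e\<rfloor> else nat \<lceil>c e\<rceil>)" for e
  have JE: "J \<subseteq> E" using J by (simp add: min_join_def)
  have "min_join E (\<lambda>e. real (k e)) J"
  proof (rule min_join_mono[OF finite_edges J])
    show "real (k e) \<le> c e" if "e \<in> J" for e
      using that nonneg JE by (auto simp: k_def)
    show "c e \<le> real (k e)" if "e \<in> E - J" for e
      using that by (simp add: k_def) linarith
  qed
  moreover have "\<bar>c e - real (k e)\<bar> \<le> 1" if "e \<in> E" for e
    using nonneg[OF that] by (simp add: k_def) linarith
  ultimately show ?thesis using that by simp
qed

lemma min_join_weight_le:
  assumes J: "min_join E c J" and nonneg: "\<And>e. e \<in> E \<Longrightarrow> 0 \<le> c e" and x: "x \<in> join_cone E J"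
  shows "dotp E c (indicator J) \<le> dotp E c x"
proof -
  define z where "z e = indicator J e - x e" for e
  have JE: "J \<subseteq> E" using J by (simp add: min_join_def)
  have dotp_z: "dotp E a z = dotp E a (indicator J) - dotp E a x" for a
    by (simp add: dotp_def z_def right_diff_distrib sum_subtractf)
  have "real N * dotp E c z \<le> (\<Sum>e\<in>E. \<bar>z e\<bar>)" for N
  proof -
    obtain k where k: "min_join E k J" and round: "\<And>e. e \<in> E \<Longrightarrow> \<bar>real N * c e - real (k e)\<bar> \<le> 1"
      using min_join_rounding[OF min_join_scale[OF J, of "real N"]] nonneg by auto
    have "min_join E (\<lambda>e. 2 * k e) J" using min_join_scale[OF k, of 2] by simp
    then have "real (\<Sum>e\<in>J. 2 * k e) \<le> dotp E (\<lambda>e. real (2 * k e)) x"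
      by (intro even_min_join_weight_le x) (simp_all flip: sum_distrib_left)
    then have "dotp E (\<lambda>e. real (k e)) z \<le> 0"
      by (simp add: dotp_z dotp_indicator[OF finite_edges JE])
        (simp add: dotp_def mult.assoc flip: sum_distrib_left)
    moreover have "(real N * c e - real (k e)) * z e \<le> \<bar>z e\<bar>" if "e \<in> E" for e
      using mult_right_mono[OF round[OF that], of "\<bar>z e\<bar>"] by (simp add: abs_mult[symmetric])
    then have "(\<Sum>e\<in>E. (real N * c e - real (k e)) * z e) \<le> (\<Sum>e\<in>E. \<bar>z e\<bar>)"
      by (rule sum_mono)
    ultimately show ?thesis
      by (simp add: dotp_def left_diff_distrib sum_subtractf mult.assoc flip: sum_distrib_left)
  qed
  then have "dotp E c z \<le> 0" by (rule nonpos_if_nat_multiples_bounded)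
  then show ?thesis by (simp add: dotp_z)
qed

end

section \<open>Preflows\<close>

lemma exists_saturating_decrease:
  fixes g :: "'a \<Rightarrow> real"
  assumes fin: "finite \<C>" "\<And>C. C \<in> \<C> \<Longrightarrow> finite C"
    and nonneg: "0 \<le> g a" and cover: "\<And>C. C \<in> \<C> \<Longrightarrow> b C \<le> sum g C"
  shows "\<exists>r\<ge>0. r \<le> g a \<and>
    (\<forall>C\<in>\<C>. b C \<le> sum (g(a := r)) C \<and> (sum g C = b C \<longrightarrow> sum (g(a := r)) C = b C)) \<and>
    (0 < r \<longrightarrow> (\<exists>C\<in>\<C>. a \<in> C \<and> sum (g(a := r)) C = b C))"
proof -
  define X where "X = insert (g a) ((\<lambda>C. sum g C - b C) ` {C\<in>\<C>. a \<in> C})"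
  define d where "d = Min X"
  have X: "finite X" "X \<noteq> {}" using fin(1) by (simp_all add: X_def)
  have d_le: "d \<le> g a" "\<And>C. C \<in> \<C> \<Longrightarrow> a \<in> C \<Longrightarrow> d \<le> sum g C - b C"
    using X(1) by (auto simp: d_def X_def)
  have "0 \<le> x" if "x \<in> X" for x using that nonneg cover by (auto simp: X_def)
  then have d_nonneg: "0 \<le> d" using Min_in[OF X] by (simp add: d_def)
  have sum_decrease: "sum (g(a := g a - d)) C = sum g C - (if a \<in> C then d else 0)" if "C \<in> \<C>" for C
  proof (cases "a \<in> C")
    case True
    then show ?thesis using fin(2)[OF that] by (simp add: sum.remove[of C a])
  next
    case False
    then show ?thesis by (auto intro!: sum.cong)
  qed
  have "\<exists>C\<in>\<C>. a \<in> C \<and> sum (g(a := g a - d)) C = b C" if "0 < g a - d"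
  proof -
    have "d \<noteq> g a" using that by simp
    then obtain C where C: "C \<in> \<C>" "a \<in> C" "d = sum g C - b C"
      using Min_in[OF X] by (auto simp: d_def X_def)
    then have "sum (g(a := g a - d)) C = b C" unfolding sum_decrease[OF C(1)] by simp
    then show ?thesis using C(1,2) by blast
  qed
  moreover have "b C \<le> sum (g(a := g a - d)) C" if "C \<in> \<C>" for C
    unfolding sum_decrease[OF that] using d_le(2)[OF that] cover[OF that] by auto
  moreover have "sum (g(a := g a - d)) C = b C" if "C \<in> \<C>" "sum g C = b C" for C
    unfolding sum_decrease[OF that(1)] using d_le(2)[OF that(1)] d_nonneg that(2) by auto
  moreover have "0 \<le> g a - d" "g a - d \<le> g a" using d_le(1) d_nonneg by simp_all
  ultimately show ?thesis by (intro exI[of _ "g a - d"]) blast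
qed

lemma exists_saturated_subweight:
  fixes k :: "'a \<Rightarrow> real"
  assumes A: "finite A" "\<C> \<subseteq> Pow A" and nonneg: "\<And>a. a \<in> A \<Longrightarrow> 0 \<le> k a"
    and cover: "\<And>C. C \<in> \<C> \<Longrightarrow> b C \<le> sum k C"
  shows "\<exists>g. (\<forall>a\<in>A. 0 \<le> g a \<and> g a \<le> k a) \<and> (\<forall>C\<in>\<C>. b C \<le> sum g C) \<and>
    (\<forall>a\<in>A. 0 < g a \<longrightarrow> (\<exists>C\<in>\<C>. a \<in> C \<and> sum g C = b C))"
proof -
  have fin\<C>: "finite \<C>" using A finite_subset by auto
  have finC: "finite C" if "C \<in> \<C>" for C using that A finite_subset by blast
  have "\<exists>g. (\<forall>a\<in>A. 0 \<le> g a \<and> g a \<le> k a) \<and> (\<forall>C\<in>\<C>. b C \<le> sum g C) \<and>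
      (\<forall>a\<in>B. 0 < g a \<longrightarrow> (\<exists>C\<in>\<C>. a \<in> C \<and> sum g C = b C))" if "finite B" "B \<subseteq> A" for B
    using that
  proof (induction B rule: finite_induct)
    case empty
    then show ?case using nonneg cover by (intro exI[of _ k]) auto
  next
    case (insert a B)
    then obtain g where g: "\<forall>a\<in>A. 0 \<le> g a \<and> g a \<le> k a" "\<forall>C\<in>\<C>. b C \<le> sum g C"
      and sat: "\<forall>a\<in>B. 0 < g a \<longrightarrow> (\<exists>C\<in>\<C>. a \<in> C \<and> sum g C = b C)" by auto
    have "0 \<le> g a" using g(1) insert.prems by blast
    from exists_saturating_decrease[of \<C> g a b, OF fin\<C> finC this] g(2) obtain r
      where r: "0 \<le> r" "r \<le> g a"
        and tight: "\<forall>C\<in>\<C>. b C \<le> sum (g(a := r)) C \<and> (sum g C = b C \<longrightarrow> sum (g(a := r)) C = b C)"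
        and sat_a: "0 < r \<longrightarrow> (\<exists>C\<in>\<C>. a \<in> C \<and> sum (g(a := r)) C = b C)"
      by blast
    have "\<exists>C\<in>\<C>. e \<in> C \<and> sum (g(a := r)) C = b C" if e: "e \<in> insert a B" "0 < (g(a := r)) e" for e
    proof (cases "e = a")
      case True
      then show ?thesis using e(2) sat_a by simp
    next
      case False
      then have "\<exists>C\<in>\<C>. e \<in> C \<and> sum g C = b C" using e sat by simp
      then show ?thesis using tight by blast
    qed
    moreover have "\<forall>e\<in>A. 0 \<le> (g(a := r)) e \<and> (g(a := r)) e \<le> k e" using g(1) r by force
    ultimately show ?case using tight by blast
  qed
  from this[OF A(1) order_refl] show ?thesis .
qed

definition excess :: "'v set \<Rightarrow> ('v \<times> 'v \<Rightarrow> real) \<Rightarrow> 'v \<Rightarrow> real" where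
  "excess V g u = (\<Sum>w\<in>V. g (w, u)) - (\<Sum>w\<in>V. g (u, w))"

definition inflow :: "'v set \<Rightarrow> ('v \<times> 'v \<Rightarrow> real) \<Rightarrow> 'v set \<Rightarrow> real" where
  "inflow V g S = sum g ((V - S) \<times> S)"

definition st_cuts :: "'v set \<Rightarrow> 'v \<Rightarrow> 'v \<Rightarrow> 'v set set" where
  "st_cuts V s t = {S. S \<subseteq> V \<and> s \<notin> S \<and> t \<in> S}"

text \<open>The arcs in \<open>U\<close> have unbounded capacity.\<close>

definition preflow ::
    "'v set \<Rightarrow> ('v \<times> 'v) set \<Rightarrow> ('v \<times> 'v \<Rightarrow> real) \<Rightarrow> 'v \<Rightarrow> 'v \<Rightarrow> real \<Rightarrow> ('v \<times> 'v \<Rightarrow> real) \<Rightarrow> bool" where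
  "preflow V U k s t v g \<longleftrightarrow> (\<forall>a\<in>V \<times> V. 0 \<le> g a) \<and> (\<forall>a\<in>V \<times> V - U. g a \<le> k a) \<and>
     (\<forall>u\<in>V - {s}. (if u = t then v else 0) \<le> excess V g u)"

lemma sum_excess:
  assumes V: "finite V" and S: "S \<subseteq> V"
  shows "(\<Sum>u\<in>S. excess V g u) = inflow V g S - sum g (S \<times> (V - S))"
proof -
  have split: "sum h V = sum h S + sum h (V - S)" for h :: "'a \<Rightarrow> real"
    using sum.subset_diff[OF S V, of h] by simp
  have "(\<Sum>u\<in>S. \<Sum>w\<in>V. g (w, u)) = (\<Sum>w\<in>V. \<Sum>u\<in>S. g (w, u))" by (rule sum.swap)
  then show ?thesis
    by (simp add: excess_def inflow_def sum_subtractf sum.cartesian_product' split sum.distrib)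
qed

lemma preflow_value_le_inflow:
  assumes V: "finite V" and S: "S \<in> st_cuts V s t" and disj: "(V - S) \<times> S \<inter> U = {}"
    and g: "preflow V U k s t v g"
  shows "v \<le> inflow V k S"
proof -
  have S': "S \<subseteq> V" "s \<notin> S" "t \<in> S" using S by (auto simp: st_cuts_def)
  have nonneg: "0 \<le> g a" if "a \<in> V \<times> V" for a using g that unfolding preflow_def by blast
  have "v = (\<Sum>u\<in>S. if u = t then v else 0)" using S' finite_subset[OF S'(1) V] by simp
  also have "\<dots> \<le> (\<Sum>u\<in>S. excess V g u)"
  proof (rule sum_mono)
    fix u assume "u \<in> S"
    then have "u \<in> V - {s}" using S' by blast
    then show "(if u = t then v else 0) \<le> excess V g u" using g by (simp add: preflow_def)
  qed
  also have "\<dots> = inflow V g S - sum g (S \<times> (V - S))" by (rule sum_excess[OF V S'(1)])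
  also have "0 \<le> sum g (S \<times> (V - S))" using S'(1) by (intro sum_nonneg nonneg) auto
  then have "inflow V g S - sum g (S \<times> (V - S)) \<le> inflow V g S" by simp
  also have "\<dots> \<le> inflow V k S"
    unfolding inflow_def
  proof (rule sum_mono)
    fix a assume "a \<in> (V - S) \<times> S"
    then have "a \<in> V \<times> V - U" using S'(1) disj by blast
    then show "g a \<le> k a" using g by (simp add: preflow_def)
  qed
  finally show ?thesis .
qed

lemma inflow_Un_Int_le:
  assumes V: "finite V" and nonneg: "\<And>a. a \<in> V \<times> V \<Longrightarrow> 0 \<le> g a" and AB: "A \<subseteq> V" "B \<subseteq> V"
  shows "inflow V g (A \<union> B) + inflow V g (A \<inter> B) \<le> inflow V g A + inflow V g B"
proof -
  define h where "h S a = (if a \<in> (V - S) \<times> S then g a else 0)" for S a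
  have inflow: "inflow V g S = sum (h S) (V \<times> V)" if "S \<subseteq> V" for S
  proof -
    have "V \<times> V \<inter> (V - S) \<times> S = (V - S) \<times> S" using that by blast
    then show ?thesis
      using V sum.inter_restrict[of "V \<times> V" g "(V - S) \<times> S"] by (simp add: inflow_def h_def)
  qed
  have "h (A \<union> B) a + h (A \<inter> B) a \<le> h A a + h B a" if "a \<in> V \<times> V" for a
    using nonneg[OF that] by (cases a) (simp add: h_def)
  then have "sum (h (A \<union> B)) (V \<times> V) + sum (h (A \<inter> B)) (V \<times> V)
      \<le> sum (h A) (V \<times> V) + sum (h B) (V \<times> V)"
    unfolding sum.distrib[symmetric] by (rule sum_mono)
  moreover have "A \<union> B \<subseteq> V" "A \<inter> B \<subseteq> V" using AB by auto
  ultimately show ?thesis using AB by (simp only: inflow)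
qed

lemma inflow_insert_le:
  assumes V: "finite V" and nonneg: "\<And>a. a \<in> V \<times> V \<Longrightarrow> 0 \<le> g a"
    and B: "B \<subseteq> V" and u: "u \<in> V - B" and out: "\<And>w. w \<in> V - B \<Longrightarrow> g (u, w) = 0"
  shows "inflow V g (insert u B) \<le> inflow V g B + excess V g u"
proof -
  define R where "R = V - insert u B"
  have fin: "finite B" "finite R" using V B finite_subset by (auto simp: R_def)
  have "inflow V g (insert u B) = (\<Sum>w\<in>R. g (w, u)) + sum g (R \<times> B)"
    using fin u by (simp add: inflow_def sum.cartesian_product' sum.distrib R_def)
  moreover have "V - B = insert u R" "u \<notin> R" using u by (auto simp: R_def)
  then have "inflow V g B = (\<Sum>w\<in>B. g (u, w)) + sum g (R \<times> B)"
    using fin by (simp add: inflow_def sum.cartesian_product')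
  moreover have "(\<Sum>w\<in>V. g (u, w)) = (\<Sum>w\<in>B. g (u, w))"
    using V B out by (intro sum.mono_neutral_right) auto
  moreover have "(\<Sum>w\<in>R. g (w, u)) \<le> (\<Sum>w\<in>V. g (w, u))"
    using V u nonneg by (intro sum_mono2) (auto simp: R_def)
  ultimately show ?thesis by (simp add: excess_def)
qed

lemma inflow_Union_tight:
  assumes V: "finite V" and nonneg: "\<And>a. a \<in> V \<times> V \<Longrightarrow> 0 \<le> g a"
    and cuts: "\<And>S. S \<in> st_cuts V s t \<Longrightarrow> v \<le> inflow V g S"
    and \<U>: "finite \<U>" "\<U> \<noteq> {}" "\<And>S. S \<in> \<U> \<Longrightarrow> S \<in> st_cuts V s t \<and> inflow V g S = v"
  shows "\<Union>\<U> \<in> st_cuts V s t \<and> inflow V g (\<Union>\<U>) = v"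
  using \<U>
proof (induction rule: finite_ne_induct)
  case (singleton S)
  then show ?case by simp
next
  case (insert S \<U>)
  have S: "S \<in> st_cuts V s t" "inflow V g S = v" using insert.prems by simp_all
  have B: "\<Union>\<U> \<in> st_cuts V s t" "inflow V g (\<Union>\<U>) = v" using insert.IH insert.prems by simp_all
  have cut: "S \<union> \<Union>\<U> \<in> st_cuts V s t" "S \<inter> \<Union>\<U> \<in> st_cuts V s t"
    using S(1) B(1) by (auto simp: st_cuts_def)
  have "inflow V g (S \<union> \<Union>\<U>) + inflow V g (S \<inter> \<Union>\<U>) \<le> inflow V g S + inflow V g (\<Union>\<U>)"
    using S(1) B(1) by (intro inflow_Un_Int_le[OF V nonneg]) (auto simp: st_cuts_def)
  then show ?case using cuts[OF cut(1)] cuts[OF cut(2)] S(2) B(2) cut(1) by simp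
qed

text \<open>All arcs leaving \<open>u\<close> enter the largest tight set \<open>B\<close> avoiding \<open>u\<close>, and the cut condition for
  \<open>B \<union> {u}\<close> bounds the excess of \<open>u\<close>: saturated capacities are a preflow themselves.\<close>

lemma excess_ge_if_saturated:
  assumes V: "finite V" and nonneg: "\<And>a. a \<in> V \<times> V \<Longrightarrow> 0 \<le> g a"
    and cuts: "\<And>S. S \<in> st_cuts V s t \<Longrightarrow> v \<le> inflow V g S"
    and sat: "\<And>a. a \<in> V \<times> V \<Longrightarrow> 0 < g a \<Longrightarrow>
      \<exists>S\<in>st_cuts V s t. a \<in> (V - S) \<times> S \<and> inflow V g S = v"
    and u: "u \<in> V - {s}"
  shows "(if u = t then v else 0) \<le> excess V g u"
proof -
  define \<U> where "\<U> = {S \<in> st_cuts V s t. inflow V g S = v \<and> u \<notin> S}"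
  define B where "B = \<Union>\<U>"
  have B: "B \<subseteq> V" "s \<notin> B" "u \<notin> B" by (auto simp: B_def \<U>_def st_cuts_def)
  have "g (u, w) = 0" if w: "w \<in> V - B" for w
  proof (rule ccontr)
    assume "g (u, w) \<noteq> 0"
    then have "0 < g (u, w)" using nonneg[of "(u, w)"] w u by simp
    then obtain S where "S \<in> st_cuts V s t" "(u, w) \<in> (V - S) \<times> S" "inflow V g S = v"
      using sat[of "(u, w)"] w u by auto
    then show False using w by (auto simp: B_def \<U>_def)
  qed
  then have exc: "inflow V g (insert u B) \<le> inflow V g B + excess V g u"
    using B u by (intro inflow_insert_le[OF V nonneg]) auto
  show ?thesis
  proof (cases "\<U> = {}")
    case True
    then have "B = {}" by (simp add: B_def)
    moreover have "0 \<le> inflow V g {u}"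
      unfolding inflow_def using u by (intro sum_nonneg nonneg) auto
    moreover have "v \<le> inflow V g {t}" if "u = t"
      using that u by (intro cuts) (auto simp: st_cuts_def)
    ultimately show ?thesis using exc by (auto simp: inflow_def)
  next
    case False
    have "finite \<U>" using V by (simp add: \<U>_def st_cuts_def)
    then have "B \<in> st_cuts V s t \<and> inflow V g B = v"
      unfolding B_def using False by (intro inflow_Union_tight V nonneg cuts) (simp_all add: \<U>_def)
    then have tight: "B \<in> st_cuts V s t" "inflow V g B = v" by simp_all
    then have "u \<noteq> t" "insert u B \<in> st_cuts V s t" using B(3) u by (auto simp: st_cuts_def)
    then have "v \<le> inflow V g (insert u B)" by (intro cuts)
    then show ?thesis using exc tight(2) \<open>u \<noteq> t\<close> by simp
  qed
qed

lemma exists_preflow: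
  assumes V: "finite V" and k: "\<And>a. a \<in> V \<times> V \<Longrightarrow> 0 \<le> k a"
    and cuts: "\<And>S. S \<in> st_cuts V s t \<Longrightarrow> v \<le> inflow V k S"
  shows "\<exists>g. preflow V {} k s t v g"
proof -
  let ?\<C> = "(\<lambda>S. (V - S) \<times> S) ` st_cuts V s t"
  have "?\<C> \<subseteq> Pow (V \<times> V)" by (auto simp: st_cuts_def)
  moreover have "v \<le> sum k C" if "C \<in> ?\<C>" for C using that cuts by (auto simp: inflow_def)
  ultimately have "\<exists>g. (\<forall>a\<in>V \<times> V. 0 \<le> g a \<and> g a \<le> k a) \<and> (\<forall>C\<in>?\<C>. v \<le> sum g C) \<and>
      (\<forall>a\<in>V \<times> V. 0 < g a \<longrightarrow> (\<exists>C\<in>?\<C>. a \<in> C \<and> sum g C = v))"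
    by (intro exists_saturated_subweight finite_cartesian_product V k)
  then obtain g where g: "\<forall>a\<in>V \<times> V. 0 \<le> g a \<and> g a \<le> k a"
    and g_cuts: "\<forall>S\<in>st_cuts V s t. v \<le> inflow V g S"
    and sat: "\<forall>a\<in>V \<times> V. 0 < g a \<longrightarrow> (\<exists>S\<in>st_cuts V s t. a \<in> (V - S) \<times> S \<and> inflow V g S = v)"
    unfolding inflow_def ball_simps bex_simps by (elim exE conjE)
  have "(if u = t then v else 0) \<le> excess V g u" if "u \<in> V - {s}" for u
    using V _ _ _ that by (rule excess_ge_if_saturated) (use g g_cuts sat in blast)+
  then have "preflow V {} k s t v g" unfolding preflow_def using g by blast
  then show ?thesis by blast
qed

lemma exists_preflow_if_cuts:
  assumes V: "finite V" and k: "\<And>a. a \<in> V \<times> V - U \<Longrightarrow> 0 \<le> k a"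
    and cuts: "\<And>S. S \<in> st_cuts V s t \<Longrightarrow> (V - S) \<times> S \<inter> U = {} \<Longrightarrow> v \<le> inflow V k S"
  shows "\<exists>g. preflow V U k s t v g"
proof -
  define k' where "k' a = (if a \<in> U then max 0 v else k a)" for a
  have k': "0 \<le> k' a" if "a \<in> V \<times> V" for a using k that by (simp add: k'_def)
  have "max 0 v \<le> inflow V k' S" if S: "S \<in> st_cuts V s t" for S
  proof (cases "(V - S) \<times> S \<inter> U = {}")
    case True
    then have "inflow V k' S = inflow V k S"
      unfolding inflow_def by (intro sum.cong) (auto simp: k'_def)
    moreover have "0 \<le> inflow V k' S"
      unfolding inflow_def using S by (intro sum_nonneg k') (auto simp: st_cuts_def)
    ultimately show ?thesis using cuts[OF S True] by simp
  next
    case False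
    then obtain a where a: "a \<in> (V - S) \<times> S" "a \<in> U" by blast
    have SV: "S \<subseteq> V" using S by (simp add: st_cuts_def)
    then have "k' a \<le> inflow V k' S"
      unfolding inflow_def using V a(1) finite_subset[OF SV V] by (intro member_le_sum k') auto
    then show ?thesis using a(2) by (simp add: k'_def)
  qed
  from exists_preflow[OF V k' this] obtain g where "preflow V {} k' s t (max 0 v) g" ..
  then have g: "\<forall>a\<in>V \<times> V. 0 \<le> g a" "\<forall>a\<in>V \<times> V - {}. g a \<le> k' a"
    "\<forall>u\<in>V - {s}. (if u = t then max 0 v else 0) \<le> excess V g u"
    unfolding preflow_def by blast+
  have "g a \<le> k a" if "a \<in> V \<times> V - U" for a
    using that bspec[OF g(2), of a] by (simp add: k'_def)
  moreover have "(if u = t then v else 0) \<le> excess V g u" if "u \<in> V - {s}" for u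
    using bspec[OF g(3) that] by (simp split: if_splits)
  ultimately have "preflow V U k s t v g" using g(1) unfolding preflow_def by blast
  then show ?thesis by blast
qed

theorem exists_preflow_iff:
  assumes "finite V"
  shows "(\<exists>g. preflow V U k s t v g) \<longleftrightarrow> (\<forall>a\<in>V \<times> V - U. 0 \<le> k a) \<and>
    (\<forall>S\<in>st_cuts V s t. (V - S) \<times> S \<inter> U = {} \<longrightarrow> v \<le> inflow V k S)"
    (is "_ \<longleftrightarrow> ?nonneg \<and> ?cuts")
proof
  assume "\<exists>g. preflow V U k s t v g"
  then obtain g where g: "preflow V U k s t v g" ..
  then have ?nonneg unfolding preflow_def by (meson DiffD1 order_trans)
  then show "?nonneg \<and> ?cuts" using preflow_value_le_inflow[OF assms _ _ g] by blast
next
  assume "?nonneg \<and> ?cuts"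
  then show "\<exists>g. preflow V U k s t v g" by (intro exists_preflow_if_cuts[OF assms]) blast+
qed

section \<open>Affine dimension and facets\<close>

lemma sum_fun_apply: "(\<Sum>a\<in>A. f a) x = (\<Sum>a\<in>A. f a x :: 'b::comm_monoid_add)"
  by (induction A rule: infinite_finite_induct) auto

lemma card_le_if_linearly_independent:
  fixes S :: "('i \<Rightarrow> real) set"
  assumes I: "finite I" and S: "finite S" "S \<subseteq> fspace I"
    and indep: "\<And>u. (\<And>i. (\<Sum>y\<in>S. u y * y i) = 0) \<Longrightarrow> \<forall>y\<in>S. u y = 0"
  shows "card S \<le> card I"
proof -
  interpret vector_space "\<lambda>r (y :: 'i \<Rightarrow> real) i. r * y i"
    by unfold_locales (auto simp: algebra_simps)
  let ?unit = "\<lambda>i j :: 'i. of_bool (i = j) :: real"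
  have "S \<subseteq> span (?unit ` I)"
  proof
    fix y assume "y \<in> S"
    then have "y i = 0" if "i \<notin> I" for i using S(2) that by (auto simp: fspace_def)
    then have "y = (\<Sum>i\<in>I. (\<lambda>j. y i * ?unit i j))"
      using I by (auto simp: fun_eq_iff sum_fun_apply of_bool_def if_distrib cong: if_cong)
    also have "\<dots> \<in> span (?unit ` I)" by (intro span_sum span_scale span_base) auto
    finally show "y \<in> span (?unit ` I)" .
  qed
  moreover have "independent S"
    using indep by (intro independent_if_scalars_zero S(1)) (simp add: fun_eq_iff sum_fun_apply)
  ultimately have "card S \<le> card (?unit ` I)"
    using independent_span_bound[OF finite_imageI[OF I]] by blast
  also have "\<dots> \<le> card I" by (rule card_image_le[OF I])
  finally show ?thesis .
qed

lemma aff_indep_card_le: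
  fixes B :: "('i \<Rightarrow> real) set"
  assumes D: "finite D" and B: "B \<subseteq> fspace D" "aff_indep B"
  shows "card B \<le> card D + 1"
proof -
  define lift :: "('i \<Rightarrow> real) \<Rightarrow> 'i option \<Rightarrow> real" where "lift y = case_option 1 y" for y
  have inj: "inj_on lift B" by (auto simp: inj_on_def lift_def fun_eq_iff split: option.splits)
  have fin: "finite B" using B(2) by (simp add: aff_indep_def)
  have "card (lift ` B) \<le> card (insert None (Some ` D))"
  proof (rule card_le_if_linearly_independent)
    show "lift ` B \<subseteq> fspace (insert None (Some ` D))"
      using B(1) by (auto simp: fspace_def lift_def subset_iff image_iff split: option.splits)
    fix u assume u: "(\<Sum>z\<in>lift ` B. u z * z i) = 0" for i
    have "(\<Sum>y\<in>B. u (lift y) * lift y i) = 0" for i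
      using u[of i] by (simp add: sum.reindex[OF inj])
    from this[of None] this[of "Some i" for i]
    have "(\<Sum>y\<in>B. u (lift y)) = 0" "\<And>i. (\<Sum>y\<in>B. u (lift y) * y i) = 0" by (simp_all add: lift_def)
    then have "\<forall>y\<in>B. u (lift y) = 0"
      using B(2)[unfolded aff_indep_def, THEN conjunct2, rule_format, of "\<lambda>y. u (lift y)"] by blast
    then show "\<forall>z\<in>lift ` B. u z = 0" by simp
  qed (use D fin in auto)
  then show ?thesis using D by (simp add: card_image[OF inj] card_image)
qed

lemma
  assumes D: "finite D" and S: "S \<subseteq> fspace D"
  shows card_le_adim: "\<And>B. B \<subseteq> S \<Longrightarrow> aff_indep B \<Longrightarrow> int (card B) \<le> adim S + 1"
    and exists_affine_basis: "\<exists>B\<subseteq>S. aff_indep B \<and> int (card B) = adim S + 1"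
proof -
  let ?X = "{int (card B) | B. B \<subseteq> S \<and> aff_indep B}"
  have "?X \<subseteq> int ` {..card D + 1}" using aff_indep_card_le[OF D] S by fastforce
  then have fin: "finite ?X" using finite_subset by blast
  show "int (card B) \<le> adim S + 1" if "B \<subseteq> S" "aff_indep B" for B
    unfolding adim_def using that Max_ge[OF fin, of "int (card B)"] by auto
  have "?X \<noteq> {}" by (auto simp: aff_indep_def intro!: exI[of _ "{}"])
  then have "Max ?X \<in> ?X" by (rule Max_in[OF fin])
  then show "\<exists>B\<subseteq>S. aff_indep B \<and> int (card B) = adim S + 1" unfolding adim_def by auto
qed

lemma dotp_add_scaled: "dotp D a (\<lambda>i. r * p i + q * y i) = r * dotp D a p + q * dotp D a y"
  by (simp add: dotp_def sum_distrib_left sum.distrib algebra_simps)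

lemma dotp_sum: "dotp D a (\<lambda>i. \<Sum>y\<in>B. u y * f y i) = (\<Sum>y\<in>B. u y * dotp D a (f y))"
  unfolding dotp_def sum_distrib_left by (subst sum.swap) (simp add: mult.left_commute)

lemma aff_indep_insert:
  assumes B: "aff_indep B" "\<And>y. y \<in> B \<Longrightarrow> dotp D a y = \<beta>" and z: "dotp D a z \<noteq> \<beta>"
  shows "aff_indep (insert z B)"
proof -
  have B': "finite B" "z \<notin> B" using B z by (auto simp: aff_indep_def)
  have "\<forall>y\<in>insert z B. u y = 0"
    if u: "sum u (insert z B) = 0" "\<And>i. (\<Sum>y\<in>insert z B. u y * y i) = 0" for u
  proof -
    have "0 = dotp D a (\<lambda>i. \<Sum>y\<in>insert z B. u y * y i)" by (simp only: u(2)) (simp add: dotp_def)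
    also have "\<dots> = u z * dotp D a z + sum u B * \<beta>"
      unfolding dotp_sum using B' B(2) by (simp add: sum_distrib_right)
    also have "sum u B = - u z" using u(1) B' by simp
    finally have "u z * (dotp D a z - \<beta>) = 0" by (simp add: right_diff_distrib)
    then have "u z = 0" using z by simp
    moreover have "\<forall>y\<in>B. u y = 0" using B(1) u B' \<open>u z = 0\<close> by (simp add: aff_indep_def)
    ultimately show ?thesis by simp
  qed
  then show ?thesis using B' by (simp only: aff_indep_def) blast
qed

lemma adim_less:
  assumes D: "finite D" and G: "G \<subseteq> fspace D" "F \<subseteq> G"
    and F: "\<And>y. y \<in> F \<Longrightarrow> dotp D a y = \<beta>" and z: "z \<in> G" "dotp D a z \<noteq> \<beta>"
  shows "adim F < adim G"
proof -
  obtain B where B: "B \<subseteq> F" "aff_indep B" "int (card B) = adim F + 1"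
    using exists_affine_basis[OF D, of F] G by blast
  have "aff_indep (insert z B)" using B F z(2) by (intro aff_indep_insert) auto
  moreover have "insert z B \<subseteq> G" using B(1) G(2) z(1) by blast
  ultimately have "int (card (insert z B)) \<le> adim G + 1" by (intro card_le_adim[OF D G(1)])
  moreover have "finite B" "z \<notin> B" using B F z(2) by (auto simp: aff_indep_def)
  ultimately show ?thesis using B(3) by simp
qed

definition polyhedron :: "'i set \<Rightarrow> nat \<Rightarrow> (nat \<Rightarrow> 'i \<Rightarrow> real) \<Rightarrow> (nat \<Rightarrow> real) \<Rightarrow> ('i \<Rightarrow> real) set" where
  "polyhedron D k A b = {x \<in> fspace D. \<forall>j<k. dotp D (A j) x \<le> b j}"

lemma exists_relative_interior_point:
  fixes k :: nat
  assumes F: "F \<noteq> {}" "\<And>y j. y \<in> F \<Longrightarrow> j < k \<Longrightarrow> dotp D (A j) y \<le> b j"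
    and midpoint: "\<And>y z. y \<in> F \<Longrightarrow> z \<in> F \<Longrightarrow> (\<lambda>i. 1/2 * y i + 1/2 * z i) \<in> F"
  shows "\<exists>p\<in>F. \<forall>j<k. (\<exists>y\<in>F. dotp D (A j) y < b j) \<longrightarrow> dotp D (A j) p < b j"
  using F(2)
proof (induction k)
  case 0
  then show ?case using F(1) by auto
next
  case (Suc k)
  then obtain p where p: "p \<in> F" "\<forall>j<k. (\<exists>y\<in>F. dotp D (A j) y < b j) \<longrightarrow> dotp D (A j) p < b j"
    by auto
  show ?case
  proof (cases "\<exists>y\<in>F. dotp D (A k) y < b k")
    case True
    then obtain y where y: "y \<in> F" "dotp D (A k) y < b k" by blast
    let ?m = "\<lambda>i. 1/2 * p i + 1/2 * y i"
    have "dotp D (A j) ?m < b j" if j: "j < Suc k" "\<exists>y\<in>F. dotp D (A j) y < b j" for j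
    proof -
      have "dotp D (A j) p < b j \<or> dotp D (A j) y < b j" using p(2) y(2) j by (cases "j = k") auto
      then show ?thesis
        using Suc.prems[OF p(1) j(1)] Suc.prems[OF y(1) j(1)] unfolding dotp_add_scaled by auto
    qed
    then show ?thesis using midpoint[OF p(1) y(1)] by blast
  next
    case False
    then show ?thesis using p by (intro bexI[of _ p]) (auto simp: less_Suc_eq)
  qed
qed

lemma exists_step_beyond:
  assumes pq: "p \<in> polyhedron D k A b" "q \<in> fspace D"
    and tight: "\<And>j. j < k \<Longrightarrow> dotp D (A j) p = b j \<Longrightarrow> dotp D (A j) q = b j"
  obtains \<epsilon> where "0 < \<epsilon>" "(\<lambda>i. (1 + \<epsilon>) * p i + (- \<epsilon>) * q i) \<in> polyhedron D k A b"
proof -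
  let ?r = "\<lambda>\<epsilon> i. (1 + \<epsilon>) * p i + (- \<epsilon>) * q i"
  have "\<forall>\<^sub>F \<epsilon> in at_right 0. dotp D (A j) (?r \<epsilon>) \<le> b j" if j: "j \<in> {..<k}" for j
  proof (cases "dotp D (A j) p = b j")
    case True
    then show ?thesis using tight[of j] j unfolding dotp_add_scaled by (simp add: algebra_simps)
  next
    case False
    then have "dotp D (A j) p < b j" using pq(1) j by (force simp: polyhedron_def)
    moreover have "((\<lambda>\<epsilon>. dotp D (A j) (?r \<epsilon>)) \<longlongrightarrow> (1 + 0) * dotp D (A j) p + (- 0) * dotp D (A j) q)
        (at_right 0)"
      unfolding dotp_add_scaled by (intro tendsto_intros)
    ultimately have "\<forall>\<^sub>F \<epsilon> in at_right 0. dotp D (A j) (?r \<epsilon>) < b j"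
      by (intro order_tendstoD(2)) auto
    then show ?thesis by (rule eventually_mono) simp
  qed
  then have "\<forall>\<^sub>F \<epsilon> in at_right 0. \<forall>j\<in>{..<k}. dotp D (A j) (?r \<epsilon>) \<le> b j"
    by (simp add: eventually_ball_finite)
  moreover have "\<forall>\<^sub>F \<epsilon> in at_right 0. (0 :: real) < \<epsilon>" by (rule eventually_at_right_less)
  ultimately have "\<forall>\<^sub>F \<epsilon> in at_right 0. 0 < \<epsilon> \<and> ?r \<epsilon> \<in> polyhedron D k A b"
    by eventually_elim (use pq in \<open>simp add: polyhedron_def fspace_def\<close>)
  then show ?thesis using that eventually_happens'[OF trivial_limit_at_right_real] by blast
qed

text \<open>If every inequality that is tight at a relatively interior point \<open>p\<close> of the face \<open>F\<close> were tight
  at \<open>q\<close>, then the segment from \<open>q\<close> to \<open>p\<close> could be prolonged beyond \<open>p\<close>, and \<open>q\<close> would lie in \<open>F\<close>.\<close>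

lemma exists_constraint_separating_face:
  assumes face: "face_in D F (polyhedron D k A b)" "F \<noteq> {}"
    and q: "q \<in> polyhedron D k A b" "q \<notin> F"
  obtains j where "j < k" "\<And>y. y \<in> F \<Longrightarrow> dotp D (A j) y = b j" "dotp D (A j) q \<noteq> b j"
proof -
  let ?Q = "polyhedron D k A b"
  obtain a \<beta> where valid: "\<And>y. y \<in> ?Q \<Longrightarrow> dotp D a y \<le> \<beta>" and F: "F = {y\<in>?Q. dotp D a y = \<beta>}"
    using face(1) unfolding face_in_def by blast
  have le: "dotp D (A j) y \<le> b j" if "y \<in> F" "j < k" for y j
    using that by (simp add: F polyhedron_def)
  have midpoint: "(\<lambda>i. 1/2 * y i + 1/2 * z i) \<in> F" if "y \<in> F" "z \<in> F" for y z
  proof -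
    have "1/2 * dotp D (A j) y + 1/2 * dotp D (A j) z \<le> b j" if "j < k" for j
      using le[OF \<open>y \<in> F\<close> that] le[OF \<open>z \<in> F\<close> that] by simp
    then show ?thesis
      using that unfolding F polyhedron_def mem_Collect_eq dotp_add_scaled by (simp add: fspace_def)
  qed
  have "\<exists>p\<in>F. \<forall>j<k. (\<exists>y\<in>F. dotp D (A j) y < b j) \<longrightarrow> dotp D (A j) p < b j"
    by (rule exists_relative_interior_point[OF face(2) le midpoint])
  then obtain p where p: "p \<in> F" "\<forall>j<k. (\<exists>y\<in>F. dotp D (A j) y < b j) \<longrightarrow> dotp D (A j) p < b j"
    by blast
  have "\<not> (\<forall>j<k. dotp D (A j) p = b j \<longrightarrow> dotp D (A j) q = b j)"
  proof
    assume "\<forall>j<k. dotp D (A j) p = b j \<longrightarrow> dotp D (A j) q = b j"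
    then obtain \<epsilon> where \<epsilon>: "0 < \<epsilon>" "(\<lambda>i. (1 + \<epsilon>) * p i + (- \<epsilon>) * q i) \<in> ?Q"
      using exists_step_beyond[of p D k A b q] p(1) q(1) by (auto simp: F polyhedron_def)
    have "(1 + \<epsilon>) * \<beta> + (- \<epsilon>) * dotp D a q \<le> \<beta>"
      using valid[OF \<epsilon>(2)] p(1) unfolding dotp_add_scaled F by simp
    then have "\<epsilon> * (\<beta> - dotp D a q) \<le> 0" by (simp add: algebra_simps)
    then have "\<beta> \<le> dotp D a q" using \<epsilon>(1) by (simp add: mult_le_0_iff)
    then show False using q valid[OF q(1)] by (simp add: F)
  qed
  then obtain j where j: "j < k" "dotp D (A j) p = b j" "dotp D (A j) q \<noteq> b j" by blast
  moreover have "dotp D (A j) y = b j" if "y \<in> F" for y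
    using p(2) that le[OF that j(1)] j(1,2) by fastforce
  ultimately show ?thesis using that by blast
qed

lemma facet_in_polyhedronE:
  assumes D: "finite D" and F: "facet_in D F (polyhedron D k A b)"
  obtains j where "j < k" "F = {y \<in> polyhedron D k A b. dotp D (A j) y = b j}"
proof -
  let ?Q = "polyhedron D k A b"
  have face: "face_in D F ?Q" "F \<noteq> {}" and dim: "adim F = adim ?Q - 1"
    using F by (auto simp: facet_in_def)
  have QD: "?Q \<subseteq> fspace D" by (auto simp: polyhedron_def)
  obtain a \<beta> where Fa: "F = {y\<in>?Q. dotp D a y = \<beta>}" using face(1) unfolding face_in_def by blast
  obtain q where q: "q \<in> ?Q" "q \<notin> F" using Fa dim by (cases "F = ?Q") auto
  obtain j where j: "j < k" "\<And>y. y \<in> F \<Longrightarrow> dotp D (A j) y = b j" "dotp D (A j) q \<noteq> b j"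
    using exists_constraint_separating_face[OF face q] by blast
  define G where "G = {y\<in>?Q. dotp D (A j) y = b j}"
  have "adim G < adim ?Q"
    using j(3) q(1) by (intro adim_less[OF D QD, where a = "A j" and \<beta> = "b j"]) (auto simp: G_def)
  moreover have "adim F < adim G" if "z \<in> G" "z \<notin> F" for z
    using that j(2) QD by (intro adim_less[OF D, where a = a and \<beta> = \<beta>]) (auto simp: G_def Fa)
  moreover have "F \<subseteq> G" using Fa j(2) by (auto simp: G_def)
  ultimately have "F = G" using dim by fastforce
  then show ?thesis using that j(1) by (simp add: G_def)
qed

lemma card_facets_le:
  assumes "finite D"
  shows "card {F. facet_in D F (polyhedron D k A b)} \<le> k"
proof -
  have "{F. facet_in D F (polyhedron D k A b)} \<subseteq>
      (\<lambda>j. {y \<in> polyhedron D k A b. dotp D (A j) y = b j}) ` {..<k}"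
    by (force elim: facet_in_polyhedronE[OF assms])
  then show ?thesis using surj_card_le[of "{..<k}"] by fastforce
qed

section \<open>Extended formulations\<close>

definition affine_form :: "'i set \<Rightarrow> (('i \<Rightarrow> real) \<Rightarrow> real) \<Rightarrow> bool" where
  "affine_form I L \<longleftrightarrow> (\<exists>a \<beta>. \<forall>y. L y = dotp I a y + \<beta>)"

definition linear_system :: "'i set \<Rightarrow> nat \<Rightarrow> (('i \<Rightarrow> real) \<Rightarrow> bool) \<Rightarrow> bool" where
  "linear_system I k R \<longleftrightarrow> (\<exists>A b. \<forall>y. R y \<longleftrightarrow> (\<forall>j<k. dotp I (A j) y \<le> b j))"

lemma affine_formI: "(\<And>y. L y = dotp I a y + \<beta>) \<Longrightarrow> affine_form I L"
  unfolding affine_form_def by blast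

lemma affine_form_const: "affine_form I (\<lambda>y. r)"
  by (rule affine_formI[of _ _ "\<lambda>_. 0" r]) (simp add: dotp_def)

lemma affine_form_coord:
  assumes "finite I" "i \<in> I"
  shows "affine_form I (\<lambda>y. y i)"
  using assms by (intro affine_formI[of _ _ "\<lambda>j. of_bool (j = i)" 0])
    (simp add: dotp_def of_bool_def if_distrib[of "\<lambda>r. r * _"] cong: if_cong)

lemma affine_form_add:
  assumes "affine_form I L" "affine_form I M"
  shows "affine_form I (\<lambda>y. L y + M y)"
proof -
  obtain a \<alpha> b \<beta> where "\<And>y. L y = dotp I a y + \<alpha>" "\<And>y. M y = dotp I b y + \<beta>"
    using assms unfolding affine_form_def by blast
  then show ?thesis
    by (intro affine_formI[of _ _ "\<lambda>i. a i + b i" "\<alpha> + \<beta>"])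
      (simp add: dotp_def sum.distrib distrib_right)
qed

lemma affine_form_scale:
  assumes "affine_form I L"
  shows "affine_form I (\<lambda>y. r * L y)"
proof -
  obtain a \<beta> where "\<And>y. L y = dotp I a y + \<beta>" using assms unfolding affine_form_def by blast
  then show ?thesis
    by (intro affine_formI[of _ _ "\<lambda>i. r * a i" "r * \<beta>"])
      (simp add: dotp_def sum_distrib_left distrib_left mult.assoc)
qed

lemma affine_form_diff:
  "affine_form I L \<Longrightarrow> affine_form I M \<Longrightarrow> affine_form I (\<lambda>y. L y - M y)"
  using affine_form_add[OF _ affine_form_scale[of I M "-1"], of L] by simp

lemma affine_form_sum:
  "(\<And>x. x \<in> X \<Longrightarrow> affine_form I (L x)) \<Longrightarrow> affine_form I (\<lambda>y. \<Sum>x\<in>X. L x y)"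
  by (induction X rule: infinite_finite_induct) (simp_all add: affine_form_const affine_form_add)

lemma affine_form_If:
  "(P \<Longrightarrow> affine_form I L) \<Longrightarrow> (\<not> P \<Longrightarrow> affine_form I M) \<Longrightarrow>
    affine_form I (\<lambda>y. if P then L y else M y)"
  by (cases P) simp_all

lemma linear_system_le:
  assumes "affine_form I L" "affine_form I M"
  shows "linear_system I 1 (\<lambda>y. L y \<le> M y)"
proof -
  obtain a \<beta> where "\<And>y. L y - M y = dotp I a y + \<beta>"
    using affine_form_diff[OF assms] unfolding affine_form_def by blast
  then have "L y \<le> M y \<longleftrightarrow> dotp I a y \<le> - \<beta>" for y by (smt (verit))
  then show ?thesis unfolding linear_system_def by (intro exI[of _ "\<lambda>_. a"] exI[of _ "\<lambda>_. - \<beta>"]) simp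
qed

lemma linear_system_conj:
  assumes "linear_system I k R" "linear_system I l S"
  shows "linear_system I (k + l) (\<lambda>y. R y \<and> S y)"
proof -
  obtain A a where R: "\<And>y. R y \<longleftrightarrow> (\<forall>j<k. dotp I (A j) y \<le> a j)"
    using assms(1) unfolding linear_system_def by blast
  obtain B b where S: "\<And>y. S y \<longleftrightarrow> (\<forall>j<l. dotp I (B j) y \<le> b j)"
    using assms(2) unfolding linear_system_def by blast
  have split: "(\<forall>j<k + l. Q j) \<longleftrightarrow> (\<forall>j<k. Q j) \<and> (\<forall>j<l. Q (k + j))" for Q
    by (metis add_less_cancel_left le_Suc_ex not_le trans_less_add1)
  show ?thesis
    unfolding linear_system_def
    by (intro exI[of _ "\<lambda>j. if j < k then A j else B (j - k)"]
        exI[of _ "\<lambda>j. if j < k then a j else b (j - k)"]) (simp add: R S split)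
qed

lemma linear_system_ball:
  assumes "finite X" "\<And>x. x \<in> X \<Longrightarrow> linear_system I (k x) (R x)"
  shows "linear_system I (sum k X) (\<lambda>y. \<forall>x\<in>X. R x y)"
  using assms
proof (induction X rule: finite_induct)
  case empty
  then show ?case by (simp add: linear_system_def)
next
  case (insert x X)
  then show ?case using linear_system_conj[of I "k x" "R x"] by simp
qed

lemma linear_system_substitute:
  assumes "linear_system I k R" and h: "\<And>i. i \<in> I \<Longrightarrow> affine_form I' (\<lambda>y. h y i)"
  shows "linear_system I' k (\<lambda>y. R (h y))"
proof -
  obtain A b where R: "\<And>y. R y \<longleftrightarrow> (\<forall>j<k. dotp I (A j) y \<le> b j)"
    using assms(1) unfolding linear_system_def by blast
  have "affine_form I' (\<lambda>y. dotp I (A j) (h y))" for j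
    unfolding dotp_def using h by (intro affine_form_sum affine_form_scale)
  then have "linear_system I' (\<Sum>j<k. 1) (\<lambda>y. \<forall>j\<in>{..<k}. dotp I (A j) (h y) \<le> b j)"
    by (intro linear_system_ball linear_system_le affine_form_const) auto
  then show ?thesis by (simp add: R lessThan_def)
qed

lemma linear_system_cong:
  assumes "linear_system I k R" "\<And>i. i \<in> I \<Longrightarrow> y i = z i"
  shows "R y \<longleftrightarrow> R z"
proof -
  have "dotp I a y = dotp I a z" for a
    unfolding dotp_def using assms(2) by (intro sum.cong) auto
  then show ?thesis using assms(1) unfolding linear_system_def by auto
qed

lemma xc_lin_map_polyhedron_le: "xc D (lin_map D m M ` polyhedron {..<m} k A b) \<le> k"
proof -
  have "polyhedron_in {..<m} (polyhedron {..<m} k A b)"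
    unfolding polyhedron_in_def polyhedron_def by blast
  then have "xc D (lin_map D m M ` polyhedron {..<m} k A b)
      \<le> card {F. facet_in {..<m} F (polyhedron {..<m} k A b)}"
    unfolding xc_def by (intro Least_le) blast
  also have "\<dots> \<le> k" by (rule card_facets_le) simp
  finally show ?thesis .
qed

lemma xc_coordinate_projection_le:
  fixes I :: "'i set"
  assumes I: "finite I" and \<phi>: "\<And>e. e \<in> D \<Longrightarrow> \<phi> e \<in> I" and R: "linear_system I k R"
  shows "xc D {\<lambda>e. if e \<in> D then y (\<phi> e) else 0 | y. R y} \<le> k"
proof -
  define m where "m = card I"
  obtain h where h: "bij_betw h I {..<m}"
    using ex_bij_betw_finite_nat[OF I] by (auto simp: m_def atLeast0LessThan)
  have h_less: "h i < m" if "i \<in> I" for i using h that by (auto simp: bij_betw_def)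
  have "linear_system {..<m} k (\<lambda>z. R (\<lambda>i. z (h i)))"
    using h_less by (intro linear_system_substitute[OF R] affine_form_coord) auto
  then obtain A b where Ab: "\<And>z. R (\<lambda>i. z (h i)) \<longleftrightarrow> (\<forall>j<k. dotp {..<m} (A j) z \<le> b j)"
    unfolding linear_system_def by blast
  define M :: "_ \<Rightarrow> nat \<Rightarrow> real" where "M e j = of_bool (j = h (\<phi> e))" for e j
  have M: "lin_map D m M z = (\<lambda>e. if e \<in> D then z (h (\<phi> e)) else 0)" for z
    using h_less[OF \<phi>]
    by (auto simp: lin_map_def M_def of_bool_def if_distrib[of "\<lambda>r. r * _"] cong: if_cong)
  have "{\<lambda>e. if e \<in> D then y (\<phi> e) else 0 | y. R y} = lin_map D m M ` polyhedron {..<m} k A b"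
  proof (intro equalityI subsetI)
    fix x assume "x \<in> {\<lambda>e. if e \<in> D then y (\<phi> e) else 0 | y. R y}"
    then obtain y where y: "R y" "x = (\<lambda>e. if e \<in> D then y (\<phi> e) else 0)" by blast
    define z where "z j = (if j < m then y (inv_into I h j) else 0)" for j
    have zh: "z (h i) = y i" if "i \<in> I" for i
      using h that h_less by (simp add: z_def bij_betw_def)
    have "R (\<lambda>i. z (h i))" using linear_system_cong[OF R, of "\<lambda>i. z (h i)" y] zh y(1) by blast
    moreover have "z \<in> fspace {..<m}" by (simp add: fspace_def z_def)
    ultimately have "z \<in> polyhedron {..<m} k A b" unfolding Ab polyhedron_def by blast
    moreover have "x = lin_map D m M z" unfolding y(2) M using zh[OF \<phi>] by auto
    ultimately show "x \<in> lin_map D m M ` polyhedron {..<m} k A b" by (intro image_eqI)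
  next
    fix x assume "x \<in> lin_map D m M ` polyhedron {..<m} k A b"
    then obtain z where "R (\<lambda>i. z (h i))" "x = lin_map D m M z"
      by (auto simp: Ab polyhedron_def)
    then show "x \<in> {\<lambda>e. if e \<in> D then y (\<phi> e) else 0 | y. R y}"
      unfolding M by (intro CollectI exI[of _ "\<lambda>i. z (h i)"] conjI)
  qed
  then show ?thesis by (simp only: xc_lin_map_polyhedron_le)
qed

lemma xc_Ball_Ex_le:
  fixes R :: "'f \<Rightarrow> ('d + 'i \<Rightarrow> real) \<Rightarrow> bool"
  assumes fin: "finite D" "finite I" "finite J"
    and R: "\<And>f. f \<in> J \<Longrightarrow> linear_system (D <+> I) (k f) (R f)"
  shows "xc D {x \<in> fspace D. \<forall>f\<in>J. \<exists>g. R f (case_sum x g)} \<le> sum k J"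
proof -
  define part :: "'f \<Rightarrow> ('d + 'f \<times> 'i \<Rightarrow> real) \<Rightarrow> 'd + 'i \<Rightarrow> real"
    where "part f y = case_sum (\<lambda>e. y (Inl e)) (\<lambda>i. y (Inr (f, i)))" for f y
  have part: "affine_form (D <+> J \<times> I) (\<lambda>y. part f y i)" if "f \<in> J" "i \<in> D <+> I" for f i
    using that fin by (cases i) (auto simp: part_def intro!: affine_form_coord)
  have system: "linear_system (D <+> J \<times> I) (sum k J) (\<lambda>y. \<forall>f\<in>J. R f (part f y))"
    by (intro linear_system_ball fin(3) linear_system_substitute[OF R] part)
  have "{x \<in> fspace D. \<forall>f\<in>J. \<exists>g. R f (case_sum x g)} =
      {\<lambda>e. if e \<in> D then y (Inl e) else 0 | y. \<forall>f\<in>J. R f (part f y)}" (is "?P = ?Q")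
  proof (intro equalityI subsetI)
    fix x assume x: "x \<in> ?P"
    then obtain g where g: "\<And>f. f \<in> J \<Longrightarrow> R f (case_sum x (g f))" by (auto dest!: bchoice)
    define y where "y = case_sum x (\<lambda>(f, i). g f i)"
    have "part f y = case_sum x (g f)" for f by (auto simp: part_def y_def split: sum.splits)
    moreover have "x = (\<lambda>e. if e \<in> D then y (Inl e) else 0)"
      using x by (auto simp: y_def fspace_def)
    ultimately show "x \<in> ?Q" using g by (intro CollectI exI[of _ y]) simp
  next
    fix x assume "x \<in> ?Q"
    then obtain y where y: "x = (\<lambda>e. if e \<in> D then y (Inl e) else 0)" "\<forall>f\<in>J. R f (part f y)"
      by blast
    have "R f (case_sum x (\<lambda>i. y (Inr (f, i))))" if "f \<in> J" for f
    proof -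
      have "part f y i = case_sum x (\<lambda>i. y (Inr (f, i))) i" if "i \<in> D <+> I" for i
        using that by (auto simp: part_def y(1))
      then show ?thesis using linear_system_cong[OF R[OF that]] y(2) that by blast
    qed
    moreover have "x \<in> fspace D" by (simp add: y(1) fspace_def)
    ultimately show "x \<in> ?P" by blast
  qed
  then show ?thesis using xc_coordinate_projection_le[OF _ _ system, of D Inl] fin by auto
qed

section \<open>The radial cone\<close>

lemma dotp_conv_hull_ge:
  assumes X: "\<And>y. y \<in> X \<Longrightarrow> \<beta> \<le> dotp D c y" and z: "z \<in> conv_hull X"
  shows "\<beta> \<le> dotp D c z"
proof -
  obtain F u where F: "F \<subseteq> X" "\<And>y. y \<in> F \<Longrightarrow> 0 \<le> u y" "sum u F = 1"
    and z: "z = (\<lambda>i. \<Sum>y\<in>F. u y * y i)"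
    using z unfolding conv_hull_def by blast
  have "\<beta> = (\<Sum>y\<in>F. u y * \<beta>)" using F(3) by (simp flip: sum_distrib_right)
  also have "\<dots> \<le> (\<Sum>y\<in>F. u y * dotp D c y)"
    using F(1,2) X by (intro sum_mono mult_left_mono) auto
  also have "\<dots> = dotp D c z" by (simp only: z dotp_sum)
  finally show ?thesis .
qed

lemma subset_conv_hull: "X \<subseteq> conv_hull X"
proof
  fix y assume "y \<in> X"
  then show "y \<in> conv_hull X"
    unfolding conv_hull_def by (intro CollectI exI[of _ "{y}"] exI[of _ "\<lambda>_. 1"]) auto
qed

lemma in_dominantI:
  assumes "p \<in> P" "r \<in> fspace D" "\<And>i. 0 \<le> r i"
  shows "(\<lambda>i. p i + r i) \<in> dominant D P"
  using assms unfolding dominant_def by blast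

lemma nonneg_if_bounded_below_on_dominant:
  assumes D: "finite D" "i \<in> D" and p: "p \<in> P"
    and bound: "\<And>y. y \<in> dominant D P \<Longrightarrow> \<beta> \<le> dotp D c y"
  shows "0 \<le> c i"
proof -
  have "real N * - c i \<le> dotp D c p - \<beta>" for N
  proof -
    have "(\<lambda>j. p j + real N * indicator {i} j) \<in> dominant D P"
      using p D(2) by (intro in_dominantI) (auto simp: fspace_def indicator_def)
    then have "\<beta> \<le> dotp D c (\<lambda>j. 1 * p j + real N * indicator {i} j)" using bound by simp
    also have "\<dots> = dotp D c p + real N * c i"
      unfolding dotp_add_scaled using dotp_indicator[OF D(1), of "{i}" c] D(2) by simp
    finally show ?thesis by simp
  qed
  then have "- c i \<le> 0" by (rule nonpos_if_nat_multiples_bounded)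
  then show ?thesis by simp
qed

lemma dominant_conv_hull_bounded_below_iff:
  assumes D: "finite D" and X: "X \<noteq> {}"
  shows "(\<forall>y\<in>dominant D (conv_hull X). \<beta> \<le> dotp D c y) \<longleftrightarrow>
    (\<forall>i\<in>D. 0 \<le> c i) \<and> (\<forall>y\<in>X. \<beta> \<le> dotp D c y)"
proof (intro iffI conjI ballI)
  fix y assume bound: "\<forall>y\<in>dominant D (conv_hull X). \<beta> \<le> dotp D c y" and "y \<in> X"
  then have "(\<lambda>i. y i + 0) \<in> dominant D (conv_hull X)"
    using subset_conv_hull by (intro in_dominantI) (auto simp: fspace_def)
  then show "\<beta> \<le> dotp D c y" using bound by simp
next
  fix i assume bound: "\<forall>y\<in>dominant D (conv_hull X). \<beta> \<le> dotp D c y" and i: "i \<in> D"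
  obtain p where "p \<in> conv_hull X" using X subset_conv_hull by blast
  then show "0 \<le> c i" using bspec[OF bound] by (rule nonneg_if_bounded_below_on_dominant[OF D i])
next
  fix y assume c: "(\<forall>i\<in>D. 0 \<le> c i) \<and> (\<forall>y\<in>X. \<beta> \<le> dotp D c y)"
    and "y \<in> dominant D (conv_hull X)"
  then obtain p r where p: "p \<in> conv_hull X" and r: "\<And>i. 0 \<le> r i" and y: "y = (\<lambda>i. p i + r i)"
    unfolding dominant_def by blast
  have "\<beta> \<le> dotp D c p" using c p by (blast intro: dotp_conv_hull_ge)
  moreover have "0 \<le> dotp D c r" unfolding dotp_def using c r by (intro sum_nonneg) simp
  moreover have "dotp D c y = dotp D c p + dotp D c r"
    by (simp add: y dotp_def sum.distrib distrib_left)
  ultimately show "\<beta> \<le> dotp D c y" by simp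
qed

lemma radial_cone_eq_lower_bounds:
  "radial_cone D P v =
    {x \<in> fspace D. \<forall>c. (\<forall>y\<in>P. dotp D c v \<le> dotp D c y) \<longrightarrow> dotp D c v \<le> dotp D c x}"
proof -
  have neg: "dotp D (\<lambda>i. - a i) y = - dotp D a y" for a y by (simp add: dotp_def sum_negf)
  have "(\<forall>a b. (\<forall>y\<in>P. dotp D a y \<le> b) \<and> dotp D a v = b \<longrightarrow> dotp D a x \<le> b) \<longleftrightarrow>
      (\<forall>c. (\<forall>y\<in>P. dotp D c v \<le> dotp D c y) \<longrightarrow> dotp D c v \<le> dotp D c x)" for x
  proof (intro iffI allI impI)
    fix c assume valid: "\<forall>a b. (\<forall>y\<in>P. dotp D a y \<le> b) \<and> dotp D a v = b \<longrightarrow> dotp D a x \<le> b"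
      and "\<forall>y\<in>P. dotp D c v \<le> dotp D c y"
    then show "dotp D c v \<le> dotp D c x"
      using valid[rule_format, of "\<lambda>i. - c i" "- dotp D c v"] by (simp add: neg)
  next
    fix a b assume valid: "\<forall>c. (\<forall>y\<in>P. dotp D c v \<le> dotp D c y) \<longrightarrow> dotp D c v \<le> dotp D c x"
      and "(\<forall>y\<in>P. dotp D a y \<le> b) \<and> dotp D a v = b"
    then show "dotp D a x \<le> b"
      using valid[rule_format, of "\<lambda>i. - a i"] by (simp add: neg)
  qed
  then show ?thesis by (simp add: radial_cone_def)
qed

lemma radial_cone_dominant_conv_hull:
  assumes "finite D" "v \<in> X"
  shows "radial_cone D (dominant D (conv_hull X)) v =
    {x \<in> fspace D. \<forall>c. (\<forall>i\<in>D. 0 \<le> c i) \<and> (\<forall>y\<in>X. dotp D c v \<le> dotp D c y) \<longrightarrow>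
      dotp D c v \<le> dotp D c x}"
proof -
  have "X \<noteq> {}" using assms(2) by blast
  then show ?thesis
    unfolding radial_cone_eq_lower_bounds
    by (simp add: dominant_conv_hull_bounded_below_iff[OF assms(1)])
qed

definition arcs :: "'v set set \<Rightarrow> ('v \<times> 'v) set" where
  "arcs F = {(u, w). {u, w} \<in> F}"

definition arc_capacity :: "'v set set \<Rightarrow> ('v set \<Rightarrow> real) \<Rightarrow> 'v \<times> 'v \<Rightarrow> real" where
  "arc_capacity F x = (\<lambda>(u, w). if {u, w} \<in> F then x {u, w} else 0)"

lemma linear_system_preflow:
  assumes V: "finite V" and v: "affine_form I v"
    and k: "\<And>a. a \<in> V \<times> V \<Longrightarrow> affine_form I (\<lambda>z. k z a)"
    and g: "\<And>a. a \<in> V \<times> V \<Longrightarrow> affine_form I (\<lambda>z. g z a)"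
  shows "linear_system I (card (V \<times> V) + (card (V \<times> V - U) + card (V - {s})))
    (\<lambda>z. preflow V U (k z) s t (v z) (g z))"
proof -
  have "linear_system I (\<Sum>a\<in>V \<times> V. 1) (\<lambda>z. \<forall>a\<in>V \<times> V. 0 \<le> g z a)"
    using V by (intro linear_system_ball linear_system_le affine_form_const g) auto
  moreover have "linear_system I (\<Sum>a\<in>V \<times> V - U. 1) (\<lambda>z. \<forall>a\<in>V \<times> V - U. g z a \<le> k z a)"
    using V by (intro linear_system_ball linear_system_le g k) auto
  moreover have "linear_system I (\<Sum>u\<in>V - {s}. 1)
      (\<lambda>z. \<forall>u\<in>V - {s}. (if u = t then v z else 0) \<le> excess V (g z) u)"
    unfolding excess_def using V
    by (intro linear_system_ball linear_system_le affine_form_If affine_form_diff affine_form_sum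
        affine_form_const v g) auto
  ultimately show ?thesis
    unfolding preflow_def card_eq_sum by (intro linear_system_conj)
qed

lemma card_preflow_constraints_le:
  assumes V: "finite V"
  shows "card (V \<times> V) + (card (V \<times> V - U) + card (V - {s})) \<le> 3 * (card V)\<^sup>2"
proof -
  have "card (V \<times> V) = (card V)\<^sup>2" by (simp add: card_cartesian_product power2_eq_square)
  moreover have "card (V \<times> V - U) \<le> card (V \<times> V)" using V by (intro card_mono) auto
  moreover have "card (V - {s}) \<le> card V" using V by (intro card_mono) auto
  moreover have "card V \<le> (card V)\<^sup>2" by (simp add: power2_eq_square)
  ultimately show ?thesis by linarith
qed

context finite_graph
begin

lemma join_cone_if_min_join_bounds:
  assumes J: "J \<subseteq> E" and x: "x \<in> fspace E"
    and valid: "\<And>c. (\<And>e. e \<in> E \<Longrightarrow> 0 \<le> c e) \<Longrightarrow> min_join E c J \<Longrightarrow> dotp E c (indicator J) \<le> dotp E c x"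
  shows "x \<in> join_cone E J"
proof -
  have count: "real (card (J \<inter> A)) \<le> sum x A"
    if "A \<subseteq> E" and le: "\<And>K. K \<in> joins E (odd_nodes J) \<Longrightarrow> card (J \<inter> A) \<le> card (K \<inter> A)" for A
  proof -
    have weight: "sum (indicator A) K = real (card (K \<inter> A))" if "K \<subseteq> E" for K
      using finite_edge_set[OF that] by (simp add: indicator_def of_bool_def sum.If_cases)
    have "min_join E (indicator A :: _ \<Rightarrow> real) J"
      unfolding min_join_def
    proof (intro conjI ballI J)
      fix K assume K: "K \<in> joins E (odd_nodes J)"
      show "sum (indicator A) J \<le> (sum (indicator A) K :: real)"
        using le[OF K] by (simp add: weight[OF J] weight[OF joins_subset[OF K]])
    qed
    then have "dotp E (indicator A) (indicator J) \<le> dotp E (indicator A) x"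
      by (intro valid) simp_all
    moreover have "dotp E (indicator A) x = dotp E x (indicator A)"
      by (simp add: dotp_def mult.commute)
    ultimately show ?thesis using J that(1) by (simp add: dotp_indicator finite_edges weight)
  qed
  have "0 \<le> x e" if "e \<in> E - J" for e using count[of "{e}"] that by simp
  moreover have "1 \<le> sum x (E \<inter> cut S)" if one: "card (J \<inter> cut S) = 1" for S
  proof -
    have cut: "K \<inter> (E \<inter> cut S) = K \<inter> cut S" if "K \<subseteq> E" for K using that by blast
    have "card (J \<inter> (E \<inter> cut S)) \<le> card (K \<inter> (E \<inter> cut S))" if "K \<in> joins E (odd_nodes J)" for K
    proof -
      have K: "K \<subseteq> E" "odd_nodes K = odd_nodes J" using that by (simp_all add: joins_def)
      then have "odd (card (K \<inter> cut S))"
        using odd_card_Int_cut[OF J, of S] odd_card_Int_cut[of K S] one by simp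
      then have "1 \<le> card (K \<inter> cut S)" by (cases "card (K \<inter> cut S)") auto
      then show ?thesis by (simp only: cut[OF J] cut[OF K(1)] one)
    qed
    from count[OF Int_lower1 this] show ?thesis by (simp add: cut[OF J] one)
  qed
  ultimately show ?thesis using x by (simp add: join_cone_def)
qed

theorem radial_cone_dominant_joins:
  assumes J: "J \<in> joins E T"
  shows "radial_cone E (dominant E (conv_hull (indicator ` joins E T))) (indicator J) = join_cone E J"
proof -
  have JE: "J \<subseteq> E" and T: "odd_nodes J = T" using J by (simp_all add: joins_def)
  have "(\<forall>y\<in>indicator ` joins E T. dotp E c (indicator J) \<le> dotp E c y) \<longleftrightarrow> min_join E c J"
    for c :: "'v set \<Rightarrow> real"
    using dotp_indicator[OF finite_edges joins_subset, of _ T c] dotp_indicator[OF finite_edges JE]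
    by (simp add: min_join_def T JE)
  then have "radial_cone E (dominant E (conv_hull (indicator ` joins E T))) (indicator J) =
      {x \<in> fspace E. \<forall>c. (\<forall>e\<in>E. 0 \<le> c e) \<and> min_join E c J \<longrightarrow>
        dotp E c (indicator J) \<le> dotp E c x}"
    using radial_cone_dominant_conv_hull[OF finite_edges imageI[OF J]] by simp
  also have "\<dots> = join_cone E J"
  proof (intro equalityI subsetI CollectI conjI allI impI)
    fix x assume "x \<in> {x \<in> fspace E. \<forall>c. (\<forall>e\<in>E. 0 \<le> c e) \<and> min_join E c J \<longrightarrow>
        dotp E c (indicator J) \<le> dotp E c x}"
    then show "x \<in> join_cone E J" by (intro join_cone_if_min_join_bounds[OF JE]) simp_all
  next
    fix x assume "x \<in> join_cone E J"
    then show "x \<in> fspace E" by (simp add: join_cone_def)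
  next
    fix x and c :: "'v set \<Rightarrow> real" assume "x \<in> join_cone E J" "(\<forall>e\<in>E. 0 \<le> c e) \<and> min_join E c J"
    then show "dotp E c (indicator J) \<le> dotp E c x" by (intro min_join_weight_le) simp_all
  qed
  finally show ?thesis .
qed

lemma inflow_arc_capacity:
  assumes F: "F \<subseteq> E" and S: "S \<subseteq> V"
  shows "inflow V (arc_capacity F x) S = sum x (F \<inter> cut S)"
proof -
  let ?e = "\<lambda>a. {fst a, snd a}"
  let ?A = "{a \<in> (V - S) \<times> S. ?e a \<in> F}"
  have "inj_on ?e ?A" by (auto simp: inj_on_def doubleton_eq_iff)
  moreover have "?e ` ?A = F \<inter> cut S"
  proof (intro equalityI subsetI)
    fix e assume e: "e \<in> F \<inter> cut S"
    then obtain u w where uw: "e = {u, w}" "u \<in> S" "w \<notin> S"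
      using cut_edge_ends[of e S] F card_edge by blast
    then have "w \<in> V" using e F edge_subset by blast
    then show "e \<in> ?e ` ?A"
      using e uw by (intro image_eqI[of _ _ "(w, u)"]) (auto simp: insert_commute)
  qed (auto simp: cut_def)
  ultimately have "bij_betw ?e ?A (F \<inter> cut S)" by (simp add: bij_betw_def)
  then have "sum x (F \<inter> cut S) = (\<Sum>a\<in>?A. x (?e a))"
    by (rule sum.reindex_bij_betw[symmetric])
  also have "\<dots> = inflow V (arc_capacity F x) S"
    using finite_subset[OF S finite_nodes] finite_nodes
    by (simp add: inflow_def arc_capacity_def case_prod_beta sum.inter_filter)
  finally show ?thesis by simp
qed

lemma arcs_disjoint_iff_cut_disjoint:
  assumes F: "F \<subseteq> E" and S: "S \<subseteq> V"
  shows "(V - S) \<times> S \<inter> arcs F = {} \<longleftrightarrow> F \<inter> cut S = {}"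
proof
  assume disj: "(V - S) \<times> S \<inter> arcs F = {}"
  have False if e: "e \<in> F" "e \<in> cut S" for e
  proof -
    obtain u w where uw: "e = {u, w}" "u \<in> S" "w \<notin> S"
      using cut_edge_ends[of e S] e F card_edge by blast
    moreover have "w \<in> V" using e uw F edge_subset by blast
    ultimately have "(w, u) \<in> (V - S) \<times> S \<inter> arcs F"
      using e by (simp add: arcs_def insert_commute)
    then show False using disj by blast
  qed
  then show "F \<inter> cut S = {}" by blast
qed (auto simp: arcs_def cut_def)

lemma exists_st_cut:
  assumes f: "{s, t} \<in> cut S" "t \<in> V"
  obtains S' where "S' \<in> st_cuts V s t" "E \<inter> cut S' = E \<inter> cut S"
proof (cases "t \<in> S")
  case True
  then have "s \<notin> S" using f by (auto simp: cut_def)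
  then show ?thesis using that[of "S \<inter> V"] True f(2) cut_Int_nodes by (simp add: st_cuts_def)
next
  case False
  then have "s \<in> S" using f by (auto simp: cut_def)
  then show ?thesis
    using that[of "- S \<inter> V"] False f(2) cut_Int_nodes[of "- S"] by (simp add: st_cuts_def)
qed

lemma arc_capacity_nonneg_iff:
  "(\<forall>a\<in>V \<times> V - arcs (J - {f}). 0 \<le> arc_capacity (E - J) x a) \<longleftrightarrow> (\<forall>e\<in>E - J. 0 \<le> x e)"
proof
  assume nonneg: "\<forall>a\<in>V \<times> V - arcs (J - {f}). 0 \<le> arc_capacity (E - J) x a"
  show "\<forall>e\<in>E - J. 0 \<le> x e"
  proof
    fix e assume e: "e \<in> E - J"
    obtain u w where uw: "e = {u, w}" using card_edge[of e] e by (auto simp: card_2_iff)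
    then have "(u, w) \<in> V \<times> V - arcs (J - {f})" using e edge_subset[of e] by (simp add: arcs_def)
    then have "0 \<le> arc_capacity (E - J) x (u, w)" using nonneg by blast
    then show "0 \<le> x e" using e uw by (simp add: arc_capacity_def)
  qed
qed (simp add: arc_capacity_def split: prod.splits)

lemma
  assumes J: "J \<subseteq> E" and f: "f \<in> J" "f \<in> cut S" and S: "S \<subseteq> V"
  shows arcs_disjoint_iff_unique_cut_edge:
      "(V - S) \<times> S \<inter> arcs (J - {f}) = {} \<longleftrightarrow> J \<inter> cut S = {f}"
    and inflow_unique_cut_edge:
      "J \<inter> cut S = {f} \<Longrightarrow> inflow V (arc_capacity (E - J) x) S = sum x (E \<inter> cut S) - x f"
proof -
  have "J - {f} \<subseteq> E" using J by blast
  then show "(V - S) \<times> S \<inter> arcs (J - {f}) = {} \<longleftrightarrow> J \<inter> cut S = {f}"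
    using f by (simp only: arcs_disjoint_iff_cut_disjoint[OF _ S]) blast
  assume "J \<inter> cut S = {f}"
  then have "E \<inter> cut S - {f} = (E - J) \<inter> cut S" "f \<in> E \<inter> cut S" using J by blast+
  then have "sum x (E \<inter> cut S) = x f + sum x ((E - J) \<inter> cut S)"
    using sum.remove[of "E \<inter> cut S" f x] finite_edges by simp
  then show "inflow V (arc_capacity (E - J) x) S = sum x (E \<inter> cut S) - x f"
    by (simp add: inflow_arc_capacity[OF Diff_subset S])
qed

text \<open>The inequalities at the cuts meeting \<open>J\<close> only in \<open>f = {s, t}\<close> say that \<open>1 - x f\<close> units can be
  sent from \<open>s\<close> to \<open>t\<close> without using \<open>f\<close>, where the other edges of \<open>J\<close> are uncapacitated.\<close>

lemma exists_preflow_iff_cut_inequalities: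
  assumes J: "J \<subseteq> E" and f: "f \<in> J" "f = {s, t}"
  shows "(\<exists>g. preflow V (arcs (J - {f})) (arc_capacity (E - J) x) s t (1 - x f) g) \<longleftrightarrow>
    (\<forall>e\<in>E - J. 0 \<le> x e) \<and> (\<forall>S. J \<inter> cut S = {f} \<longrightarrow> 1 \<le> sum x (E \<inter> cut S))"
proof -
  have tV: "t \<in> V" using J f edge_subset by blast
  have "(\<forall>S\<in>st_cuts V s t. (V - S) \<times> S \<inter> arcs (J - {f}) = {} \<longrightarrow>
        1 - x f \<le> inflow V (arc_capacity (E - J) x) S) \<longleftrightarrow>
      (\<forall>S\<in>st_cuts V s t. J \<inter> cut S = {f} \<longrightarrow> 1 \<le> sum x (E \<inter> cut S))"
  proof (rule ball_cong[OF refl])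
    fix S assume "S \<in> st_cuts V s t"
    then have S: "S \<subseteq> V" "f \<in> cut S" using f(2) by (auto simp: st_cuts_def cut_def)
    show "((V - S) \<times> S \<inter> arcs (J - {f}) = {} \<longrightarrow> 1 - x f \<le> inflow V (arc_capacity (E - J) x) S) \<longleftrightarrow>
        (J \<inter> cut S = {f} \<longrightarrow> 1 \<le> sum x (E \<inter> cut S))"
      unfolding arcs_disjoint_iff_unique_cut_edge[OF J f(1) S(2,1)]
      by (simp add: inflow_unique_cut_edge[OF J f(1) S(2,1)])
  qed
  also have "\<dots> \<longleftrightarrow> (\<forall>S. J \<inter> cut S = {f} \<longrightarrow> 1 \<le> sum x (E \<inter> cut S))"
  proof (intro iffI allI impI)
    fix S assume bound: "\<forall>S\<in>st_cuts V s t. J \<inter> cut S = {f} \<longrightarrow> 1 \<le> sum x (E \<inter> cut S)"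
      and JS: "J \<inter> cut S = {f}"
    have "{s, t} \<in> cut S" using JS f(2) by blast
    then obtain S' where S': "S' \<in> st_cuts V s t" "E \<inter> cut S' = E \<inter> cut S"
      using tV by (rule exists_st_cut)
    then have "J \<inter> cut S' = {f}" using JS J by blast
    then have "1 \<le> sum x (E \<inter> cut S')" using bound S'(1) by blast
    then show "1 \<le> sum x (E \<inter> cut S)" by (simp only: S'(2))
  qed blast
  finally show ?thesis unfolding exists_preflow_iff[OF finite_nodes] arc_capacity_nonneg_iff by simp
qed

lemma join_cone_eq_preflows:
  assumes J: "J \<subseteq> E" "J \<noteq> {}" and ends: "\<And>f. f \<in> J \<Longrightarrow> f = {src f, tgt f}"
  shows "join_cone E J = {x \<in> fspace E. \<forall>f\<in>J. \<exists>g.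
    preflow V (arcs (J - {f})) (arc_capacity (E - J) x) (src f) (tgt f) (1 - x f) g}"
proof -
  have "(\<forall>S. card (J \<inter> cut S) = 1 \<longrightarrow> 1 \<le> sum x (E \<inter> cut S)) \<longleftrightarrow>
      (\<forall>f\<in>J. \<forall>S. J \<inter> cut S = {f} \<longrightarrow> 1 \<le> sum x (E \<inter> cut S))" for x :: "'v set \<Rightarrow> real"
    by (auto simp: card_1_singleton_iff)
  moreover have
    "(\<exists>g. preflow V (arcs (J - {f})) (arc_capacity (E - J) x) (src f) (tgt f) (1 - x f) g) \<longleftrightarrow>
      (\<forall>e\<in>E - J. 0 \<le> x e) \<and> (\<forall>S. J \<inter> cut S = {f} \<longrightarrow> 1 \<le> sum x (E \<inter> cut S))"
    if "f \<in> J" for f x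
    using exists_preflow_iff_cut_inequalities[OF J(1) that ends[OF that]] .
  ultimately show ?thesis using J(2) by (auto simp: join_cone_def)
qed

theorem xc_join_cone_le:
  assumes J: "J \<subseteq> E" "J \<noteq> {}"
  shows "xc E (join_cone E J) \<le> card J * (3 * (card V)\<^sup>2)"
proof -
  have "\<forall>f\<in>J. \<exists>s t. f = {s, t}" using J(1) card_edge by (meson card_2_iff subsetD)
  then obtain src tgt where ends: "\<And>f. f \<in> J \<Longrightarrow> f = {src f, tgt f}" by metis
  define R where "R f z = preflow V (arcs (J - {f})) (arc_capacity (E - J) (\<lambda>e. z (Inl e)))
    (src f) (tgt f) (1 - z (Inl f)) (\<lambda>a. z (Inr a))" for f and z :: "'v set + 'v \<times> 'v \<Rightarrow> real"
  define k where "k f = card (V \<times> V) + (card (V \<times> V - arcs (J - {f})) + card (V - {src f}))" for f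
  have "linear_system (E <+> V \<times> V) (k f) (R f)" if "f \<in> J" for f
    unfolding R_def k_def
  proof (intro linear_system_preflow finite_nodes affine_form_diff affine_form_const)
    show "affine_form (E <+> V \<times> V) (\<lambda>z. arc_capacity (E - J) (\<lambda>e. z (Inl e)) a)" for a
      unfolding arc_capacity_def case_prod_beta
      using finite_edges finite_nodes
      by (intro affine_form_If affine_form_const affine_form_coord) auto
  qed (use that J(1) finite_edges finite_nodes in \<open>auto intro: affine_form_coord\<close>)
  then have "xc E {x \<in> fspace E. \<forall>f\<in>J. \<exists>g. R f (case_sum x g)} \<le> sum k J"
    by (intro xc_Ball_Ex_le[where I = "V \<times> V"] finite_edges finite_edge_set[OF J(1)]
        finite_cartesian_product finite_nodes)
  also have "sum k J \<le> (\<Sum>f\<in>J. 3 * (card V)\<^sup>2)"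
    unfolding k_def by (intro sum_mono card_preflow_constraints_le finite_nodes)
  also have "\<dots> = card J * (3 * (card V)\<^sup>2)" by simp
  also have "{x \<in> fspace E. \<forall>f\<in>J. \<exists>g. R f (case_sum x g)} = join_cone E J"
    unfolding R_def by (simp add: join_cone_eq_preflows[OF J ends])
  finally show ?thesis .
qed

end

section \<open>The complete graph\<close>

interpretation complete_graph: finite_graph "Vn n" "En n" for n
  by unfold_locales (auto simp: Vn_def En_def)

lemma is_Tjoin_iff_joins:
  assumes "T \<subseteq> Vn n"
  shows "is_Tjoin n T J \<longleftrightarrow> J \<in> joins (En n) T"
proof -
  have "odd_nodes J \<subseteq> Vn n" if "J \<subseteq> En n"
    using odd_nodes_subset_Union[of J] that by (auto simp: En_def)
  then show ?thesis using assms by (auto simp: is_Tjoin_def joins_def odd_nodes_def)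
qed

lemma dom_P_Tjoin_eq:
  "T \<subseteq> Vn n \<Longrightarrow> dom_P_Tjoin n T = dominant (En n) (conv_hull (indicator ` joins (En n) T))"
  by (simp add: dom_P_Tjoin_def P_Tjoin_def is_Tjoin_iff_joins setcompr_eq_image)

theorem theorem3:
  shows "\<exists>C::real. C > 0 \<and>
    (\<forall>n T J. T \<subseteq> Vn n \<longrightarrow> even (card T) \<longrightarrow> is_Tjoin n T J \<longrightarrow> J \<noteq> {} \<longrightarrow>
       is_vertex (indicator J) (dom_P_Tjoin n T) \<longrightarrow>
       real (xc (En n) (radial_cone (En n) (dom_P_Tjoin n T) (indicator J)))
         \<le> C * real (card J) * real n ^ 2)"
proof (intro exI[of _ 3] conjI allI impI)
  fix n T J
  assume T: "T \<subseteq> Vn n" and "is_Tjoin n T J" and ne: "J \<noteq> {}"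
  then have J: "J \<in> joins (En n) T" by (simp add: is_Tjoin_iff_joins)
  have "xc (En n) (join_cone (En n) J) \<le> card J * (3 * (card (Vn n))\<^sup>2)"
    using joins_subset[OF J] ne by (rule complete_graph.xc_join_cone_le)
  then have "real (xc (En n) (join_cone (En n) J)) \<le> real (card J * (3 * n\<^sup>2))"
    by (simp only: of_nat_le_iff) (simp add: Vn_def)
  then show "real (xc (En n) (radial_cone (En n) (dom_P_Tjoin n T) (indicator J)))
      \<le> 3 * real (card J) * real n ^ 2"
    by (simp add: dom_P_Tjoin_eq[OF T] complete_graph.radial_cone_dominant_joins[OF J] ac_simps)
qed simp

end
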